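(* Let $C \subset \mathbb{P}^{2}_{\mathbb{C}}$ be a reduced curve of even degree $n\geq 6$ having only ADE singularities. Let $\tau(C):=\sum_{p \in \mathrm{Sing}(C)}\tau(C,p)$ be the total Tjurina number of $C$ and let $\epsilon(C):=\sum_{p \in \mathrm{Sing}(C)}\epsilon(C,p)$. Then $C$ is an MK-curve if and only if $$\tau(C)+\epsilon(C) = \frac{n}{6}(5n-6).$$ In particular, if $C$ is an MK-curve and $s(C)$ denotes the number of singular points of $C$, then $$\tau(C)+\frac{s(C)}{2} \leq \frac{n}{6}(5n-6) < \tau(C) +s(C).$$
   Context: ADE singularities of plane curves are those locally analytically equivalent to $A_k: x^2+y^{k+1}=0$ ($k\ge 1$), $D_k: x^2y+y^{k-1}=0$ ($k\geq 4$), $E_6: x^3+y^4=0$, $E_7: x^3+xy^3=0$, $E_8: x^3+y^5=0$. The Tjurina number $\tau(C,p)$ equals the index of the type ($k$ for $A_k$ and $D_k$; $6,7,8$ for $E_6,E_7,E_8$). Let $C$ be a reduced plane curve of even degree with only ADE singularities (a "simply singular" curve), and let $X$ be the double cover of $\mathbb{P}^2_{\mathbb{C}}$ branched along $C$. Over each $p\in \mathrm{Sing}(C)$, $X$ has a rational double point of the same type. The Miyaoka-Kobayashi number of $p$ is $m(p)=3\left(e(E_p)-\frac{1}{\mathrm{ord}(G_p)}\right)-K(E_p)^2$, where $E_p$ is the exceptional curve over $p$ in the minimal resolution of $X$, $e$ is the topological Euler characteristic, $G_p$ is the associated small group, and $K(E_p)$ is the local canonical divisor (which is zero for rational double points). Explicitly,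 $m(A_k)=3(k+1)-\frac{3}{k+1}$ for $k\ge 1$, $m(D_k)=3(k+1)-\frac{3}{4(k-2)}$ for $k\ge 4$, $m(E_6)=\frac{167}{8}$, $m(E_7)=\frac{383}{16}$, $m(E_8)=\frac{1079}{40}$. Put $m(C)=\sum_{p\in \mathrm{Sing}(C)}m(p)$. MK-curve: a reduced curve $C\subset\mathbb{P}^2_{\mathbb{C}}$ of even degree $n\geq 6$ with only ADE singularities such that $m(C)=\frac{n}{2}(5n-6)$. The number $\epsilon(C,p)$ depends only on the type of $(C,p)$: $\epsilon(A_k)=\frac{k}{k+1}$ for $k\geq 1$, $\epsilon(D_k)=\frac{4k-9}{4(k-2)}$ for $k\ge 4$, $\epsilon(E_6)=\frac{23}{24}$, $\epsilon(E_7)=\frac{47}{48}$, $\epsilon(E_8)=\frac{119}{120}$. *)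

theory Defs
  imports
    "HOL-Analysis.Analysis"
    "HOL-Library.Poly_Mapping"
    "HOL-Computational_Algebra.Squarefree"
begin

section \<open>Plane curves\<close>

text \<open>
  Polynomials in three variables over the complex numbers are finitely supported maps from
  exponent vectors to coefficients; \<^typ>\<open>3\<close> is used as the type of variable indices. A reduced
  curve of degree \<open>n\<close> in the projective plane is given by its equation, a squarefree form of
  degree \<open>n\<close>, which the curve determines up to a nonzero scalar.
\<close>

type_synonym ternary_poly = "(3 \<Rightarrow>\<^sub>0 nat) \<Rightarrow>\<^sub>0 complex"

definition eval_poly :: "ternary_poly \<Rightarrow> complex ^ 3 \<Rightarrow> complex" where
  "eval_poly F v =
     (\<Sum>m\<in>Poly_Mapping.keys F. Poly_Mapping.lookup F m * (\<Prod>i\<in>UNIV. (v $ i) ^ Poly_Mapping.lookup m i))"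

definition homogeneous_of_degree :: "nat \<Rightarrow> ternary_poly \<Rightarrow> bool" where
  "homogeneous_of_degree n F \<longleftrightarrow>
     (\<forall>m\<in>Poly_Mapping.keys F. (\<Sum>i\<in>UNIV. Poly_Mapping.lookup m i) = n)"

text \<open>The zero form is not squarefree, so it is excluded here.\<close>

definition reduced_plane_curve :: "nat \<Rightarrow> ternary_poly \<Rightarrow> bool" where
  "reduced_plane_curve n F \<longleftrightarrow> homogeneous_of_degree n F \<and> squarefree F"

text \<open>Points of the projective plane are the lines through the origin of \<open>\<complex>\<^sup>3\<close>.\<close>

definition proj_point :: "complex ^ 3 \<Rightarrow> (complex ^ 3) set" where
  "proj_point v = {c *s v | c. True}"

definition Sing :: "ternary_poly \<Rightarrow> (complex ^ 3) set set" where
  "Sing F = {proj_point v | v. v \<noteq> 0 \<and> eval_poly F v = 0 \<and>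
     (eval_poly F has_derivative (\<lambda>_. 0)) (at v)}"

text \<open>
  If \<open>v\<close> spans the line \<open>p\<close> and \<open>v, a, b\<close> is a basis of \<open>\<complex>\<^sup>3\<close>, then \<open>(s, t) \<mapsto> [v + s a + t b]\<close> is an
  affine chart of the projective plane centred at \<open>p\<close>. The germ at the origin of the resulting
  equation depends on the chosen basis only up to analytic equivalence.
\<close>

definition affine_frame :: "(complex ^ 3) set \<Rightarrow> (complex ^ 3) \<times> (complex ^ 3) \<times> (complex ^ 3) \<Rightarrow> bool" where
  "affine_frame p = (\<lambda>(v, a, b). proj_point v = p \<and> det (vector [v, a, b] :: complex ^ 3 ^ 3) \<noteq> 0)"

definition local_equation :: "ternary_poly \<Rightarrow> (complex ^ 3) set \<Rightarrow> complex \<times> complex \<Rightarrow> complex" where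
  "local_equation F p =
     (case SOME w. affine_frame p w of (v, a, b) \<Rightarrow> (\<lambda>(s, t). eval_poly F (v + s *s a + t *s b)))"


section \<open>Germs of holomorphic functions at the origin of the complex plane squared\<close>

definition holomorphic2_on :: "(complex \<times> complex \<Rightarrow> complex) \<Rightarrow> (complex \<times> complex) set \<Rightarrow> bool" where
  "holomorphic2_on h S \<longleftrightarrow>
     open S \<and> (\<forall>z\<in>S. \<exists>a b. (h has_derivative (\<lambda>(u, v). a * u + b * v)) (at z))"

definition holomorphic_germs :: "(complex \<times> complex \<Rightarrow> complex) set" where
  "holomorphic_germs = {h. \<exists>S. 0 \<in> S \<and> holomorphic2_on h S}"

text \<open>
  The germs at the origin of the curves \<open>f = 0\<close> and \<open>g = 0\<close> are isomorphic: \<open>f\<close> agrees with \<open>g\<close>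
  up to a local biholomorphism \<open>\<phi>\<close> (with inverse \<open>\<psi>\<close>) and a nowhere vanishing factor \<open>u\<close>.
\<close>

definition analytically_equivalent ::
  "(complex \<times> complex \<Rightarrow> complex) \<Rightarrow> (complex \<times> complex \<Rightarrow> complex) \<Rightarrow> bool" where
  "analytically_equivalent f g \<longleftrightarrow>
     (\<exists>U V \<phi> \<psi> u. 0 \<in> U \<and> \<phi> 0 = 0 \<and> \<phi> ` U = V \<and> \<psi> ` V = U \<and>
        (\<forall>z\<in>U. \<psi> (\<phi> z) = z) \<and> (\<forall>w\<in>V. \<phi> (\<psi> w) = w) \<and>
        holomorphic2_on (fst \<circ> \<phi>) U \<and> holomorphic2_on (snd \<circ> \<phi>) U \<and>
        holomorphic2_on (fst \<circ> \<psi>) V \<and> holomorphic2_on (snd \<circ> \<psi>) V \<and>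
        holomorphic2_on u U \<and> (\<forall>z\<in>U. u z \<noteq> 0) \<and>
        (\<forall>z\<in>U. f z = u z * g (\<phi> z)))"

definition partial_x :: "(complex \<times> complex \<Rightarrow> complex) \<Rightarrow> complex \<times> complex \<Rightarrow> complex" where
  "partial_x f = (\<lambda>(x, y). deriv (\<lambda>s. f (s, y)) x)"

definition partial_y :: "(complex \<times> complex \<Rightarrow> complex) \<Rightarrow> complex \<times> complex \<Rightarrow> complex" where
  "partial_y f = (\<lambda>(x, y). deriv (\<lambda>t. f (x, t)) y)"

text \<open>
  Germs are represented by functions. Functions vanishing near the origin belong to the Tjurina
  ideal, so dividing by it also identifies functions that have the same germ.
\<close>

definition tjurina_ideal :: "(complex \<times> complex \<Rightarrow> complex) \<Rightarrow> (complex \<times> complex \<Rightarrow> complex) set" where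
  "tjurina_ideal f = {h \<in> holomorphic_germs.
     \<exists>a\<in>holomorphic_germs. \<exists>b\<in>holomorphic_germs. \<exists>c\<in>holomorphic_germs.
       \<forall>\<^sub>F z in nhds 0. h z = a z * f z + b z * partial_x f z + c z * partial_y f z}"

text \<open>
  The elements of \<open>B\<close> represent a basis of the quotient space \<open>V / W\<close>; coefficient functions are
  normalised to vanish outside \<open>B\<close> to make them unique.
\<close>

definition finite_quotient_basis ::
  "('a \<Rightarrow> complex) set \<Rightarrow> ('a \<Rightarrow> complex) set \<Rightarrow> ('a \<Rightarrow> complex) set \<Rightarrow> bool" where
  "finite_quotient_basis V W B \<longleftrightarrow> finite B \<and> B \<subseteq> V \<and>
     (\<forall>h\<in>V. \<exists>!c. (\<forall>b. b \<notin> B \<longrightarrow> c b = 0) \<and> (\<lambda>z. h z - (\<Sum>b\<in>B. c b * b z)) \<in> W)"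

definition quotient_dim :: "('a \<Rightarrow> complex) set \<Rightarrow> ('a \<Rightarrow> complex) set \<Rightarrow> nat" where
  "quotient_dim V W = (THE d. \<exists>B. finite_quotient_basis V W B \<and> card B = d)"

text \<open>The dimension of \<open>\<complex>{x, y} / (f, f\<^sub>x, f\<^sub>y)\<close>.\<close>

definition tjurina_number :: "(complex \<times> complex \<Rightarrow> complex) \<Rightarrow> nat" where
  "tjurina_number f = quotient_dim holomorphic_germs (tjurina_ideal f)"


section \<open>ADE singularities\<close>

datatype ade = Ak nat | Dk nat | E6 | E7 | E8

fun valid_ade :: "ade \<Rightarrow> bool" where
  "valid_ade (Ak k) \<longleftrightarrow> k \<ge> 1"
| "valid_ade (Dk k) \<longleftrightarrow> k \<ge> 4"
| "valid_ade E6 \<longleftrightarrow> True"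
| "valid_ade E7 \<longleftrightarrow> True"
| "valid_ade E8 \<longleftrightarrow> True"

fun normal_form :: "ade \<Rightarrow> complex \<times> complex \<Rightarrow> complex" where
  "normal_form (Ak k) (x, y) = x ^ 2 + y ^ (k + 1)"
| "normal_form (Dk k) (x, y) = x ^ 2 * y + y ^ (k - 1)"
| "normal_form E6 (x, y) = x ^ 3 + y ^ 4"
| "normal_form E7 (x, y) = x ^ 3 + x * y ^ 3"
| "normal_form E8 (x, y) = x ^ 3 + y ^ 5"

definition has_ade_type :: "ternary_poly \<Rightarrow> (complex ^ 3) set \<Rightarrow> ade \<Rightarrow> bool" where
  "has_ade_type F p T \<longleftrightarrow> valid_ade T \<and> analytically_equivalent (local_equation F p) (normal_form T)"

definition simply_singular :: "ternary_poly \<Rightarrow> bool" where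
  "simply_singular F \<longleftrightarrow> (\<forall>p\<in>Sing F. \<exists>T. has_ade_type F p T)"

text \<open>The type is unique: the normal forms are pairwise not analytically equivalent.\<close>

definition ade_type :: "ternary_poly \<Rightarrow> (complex ^ 3) set \<Rightarrow> ade" where
  "ade_type F p = (SOME T. has_ade_type F p T)"


section \<open>Local invariants\<close>

text \<open>
  The exceptional curve of the rational double point of a given type is a tree of projective
  lines, one for each vertex of the Dynkin diagram; a tree of \<open>r\<close> projective lines has Euler
  characteristic \<open>2 r - (r - 1) = r + 1\<close>.
\<close>

fun euler_exceptional :: "ade \<Rightarrow> nat" where
  "euler_exceptional (Ak k) = k + 1"
| "euler_exceptional (Dk k) = k + 1"
| "euler_exceptional E6 = 7"
| "euler_exceptional E7 = 8"
| "euler_exceptional E8 = 9"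

text \<open>
  The order of the finite subgroup \<open>G\<close> of \<open>SL\<^sub>2(\<complex>)\<close> with quotient singularity \<open>\<complex>\<^sup>2 / G\<close> of the given
  type: cyclic, or binary dihedral, tetrahedral, octahedral or icosahedral.
\<close>

fun small_group_order :: "ade \<Rightarrow> nat" where
  "small_group_order (Ak k) = k + 1"
| "small_group_order (Dk k) = 4 * (k - 2)"
| "small_group_order E6 = 24"
| "small_group_order E7 = 48"
| "small_group_order E8 = 120"

text \<open>
  The Miyaoka-Kobayashi number \<open>3 (e(E) - 1 / ord G) - K(E)\<^sup>2\<close> of a point; the local canonical
  divisor \<open>K(E)\<close> of a rational double point is zero.
\<close>

definition mk_number :: "ade \<Rightarrow> real" where
  "mk_number T = 3 * (real (euler_exceptional T) - 1 / real (small_group_order T))"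

lemma mk_number_explicit:
  "k \<ge> 1 \<Longrightarrow> mk_number (Ak k) = 3 * (real k + 1) - 3 / (real k + 1)"
  "k \<ge> 4 \<Longrightarrow> mk_number (Dk k) = 3 * (real k + 1) - 3 / (4 * (real k - 2))"
  "mk_number E6 = 167 / 8"
  "mk_number E7 = 383 / 16"
  "mk_number E8 = 1079 / 40"
  by (simp_all add: mk_number_def of_nat_diff add.commute)

fun epsilon :: "ade \<Rightarrow> real" where
  "epsilon (Ak k) = real k / (real k + 1)"
| "epsilon (Dk k) = (4 * real k - 9) / (4 * (real k - 2))"
| "epsilon E6 = 23 / 24"
| "epsilon E7 = 47 / 48"
| "epsilon E8 = 119 / 120"


section \<open>Global invariants and MK-curves\<close>

definition total_tjurina :: "ternary_poly \<Rightarrow> nat" where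
  "total_tjurina F = (\<Sum>p\<in>Sing F. tjurina_number (local_equation F p))"

definition total_epsilon :: "ternary_poly \<Rightarrow> real" where
  "total_epsilon F = (\<Sum>p\<in>Sing F. epsilon (ade_type F p))"

definition total_mk :: "ternary_poly \<Rightarrow> real" where
  "total_mk F = (\<Sum>p\<in>Sing F. mk_number (ade_type F p))"

definition MK_curve :: "nat \<Rightarrow> ternary_poly \<Rightarrow> bool" where
  "MK_curve n F \<longleftrightarrow>
     reduced_plane_curve n F \<and> even n \<and> n \<ge> 6 \<and> simply_singular F \<and>
     total_mk F = real n / 2 * (5 * real n - 6)"

end

theory Submission
  imports Defs "HOL-Complex_Analysis.Complex_Analysis"
begin

text \<open>
  Type by type, \<open>m = 3 (k + \<epsilon>)\<close>, where \<open>k\<close> is the index of the type, and \<open>1/2 \<le> \<epsilon> < 1\<close>; so everything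
  rests on the Tjurina number of an ADE point being the index of its type. Substituting the
  biholomorphism carries the Tjurina ideal of a germ to that of its normal form, because the unit and
  the chain rule only change the coefficients in the ideal. For a normal form, the division
  \<open>h(x, y) = h(0, y) + x q(x, y)\<close>, with \<open>q\<close> holomorphic by Cauchy's formula, is iterated in both
  variables. It reduces every germ to a polynomial modulo the ideal, and the Taylor coefficients it
  produces give linear functionals whose common kernel is exactly the ideal.
\<close>

section \<open>Germs of holomorphic functions of two variables\<close>

text \<open>\<open>holomorphic2_on\<close> grants complex differentiability at each point, but no
  continuity of the derivative, while a Cauchy integral can be differentiated under the integral
  sign only if the partials of the integrand are continuous. Cauchy's formula therefore enters
  twice: first for continuity of the partials, then for holomorphy of partials and difference
  quotients. Germs are functions on the whole plane that matter only near the origin, so identities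
  are stated eventually in \<open>nhds 0\<close>, and functionals must be shown not to see the
  difference. Finite expansions with holomorphic remainders take the place of convergent power
  series. \<open>quotient_dim\<close> is a definite description over all finite bases. Separating
  functionals with a dual family give a basis, force all bases to have its size, and can be pulled
  back along a biholomorphism. For \<open>Ak\<close>, \<open>E6\<close>, \<open>E8\<close> both
  partials are monomials up to a constant, and plain Taylor coefficients at the basis monomials kill
  the ideal. For \<open>Dk\<close> and \<open>E7\<close> one partial is a binomial that identifies a
  multiple of \<open>x^2\<close> with a power of \<open>y\<close>; this forces the correction term
  in the coordinates.\<close>

definition clinear2 :: "complex \<Rightarrow> complex \<Rightarrow> complex \<times> complex \<Rightarrow> complex" where
  "clinear2 a b = (\<lambda>(u, v). a * u + b * v)"

lemma holomorphic2_on_iff: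
  "holomorphic2_on h S \<longleftrightarrow> open S \<and> (\<forall>z\<in>S. \<exists>a b. (h has_derivative clinear2 a b) (at z))"
  by (simp add: holomorphic2_on_def clinear2_def)

text \<open>In filter form, finitely many conditions near the origin can be combined and then used
  at a single nearby point.\<close>

lemma holomorphic_germs_iff:
  "h \<in> holomorphic_germs \<longleftrightarrow> (\<forall>\<^sub>F z in nhds 0. \<exists>a b. (h has_derivative clinear2 a b) (at z))"
  by (auto simp: holomorphic_germs_def holomorphic2_on_iff eventually_nhds)

lemma holomorphic_germsI: "holomorphic2_on h S \<Longrightarrow> 0 \<in> S \<Longrightarrow> h \<in> holomorphic_germs"
  by (auto simp: holomorphic_germs_def)

lemma holomorphic_germs_cong:
  assumes "h \<in> holomorphic_germs" "\<forall>\<^sub>F z in nhds 0. h z = k z"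
  shows "k \<in> holomorphic_germs"
proof -
  \<comment> \<open>Agreement near 0 is agreement near every point close to 0, and this carries the
    derivative over at such a point.\<close>
  have "\<forall>\<^sub>F z in nhds 0. \<forall>\<^sub>F w in nhds z. h w = k w"
    using assms(2) by (simp add: eventually_eventually)
  then show ?thesis
    using assms(1) unfolding holomorphic_germs_iff
  proof eventually_elim
    case (elim z)
    then obtain a b where "(h has_derivative clinear2 a b) (at z)" by blast
    then have "(k has_derivative clinear2 a b) (at z)"
      by (rule has_derivative_transform_eventually)
        (use elim(1) in \<open>auto simp: eventually_at_filter elim: eventually_mono dest: eventually_nhds_x_imp_x\<close>)
    then show ?case by blast
  qed
qed

lemma clinear2_partials:
  assumes "(h has_derivative clinear2 a b) (at (x, y))"
  shows "((\<lambda>s. h (s, y)) has_field_derivative a) (at x)"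
    and "((\<lambda>t. h (x, t)) has_field_derivative b) (at y)"
    and "partial_x h (x, y) = a" and "partial_y h (x, y) = b"
proof -
  have "((\<lambda>s. h (s, y)) has_derivative (\<lambda>u. clinear2 a b (u, 0))) (at x)"
    by (rule has_derivative_compose[where f = "\<lambda>s. (s, y)", OF _ assms]) (auto intro!: derivative_eq_intros)
  then show 1: "((\<lambda>s. h (s, y)) has_field_derivative a) (at x)"
    by (simp add: has_field_derivative_def clinear2_def mult_commute_abs)
  have "((\<lambda>t. h (x, t)) has_derivative (\<lambda>u. clinear2 a b (0, u))) (at y)"
    by (rule has_derivative_compose[where f = "\<lambda>t. (x, t)", OF _ assms]) (auto intro!: derivative_eq_intros)
  then show 2: "((\<lambda>t. h (x, t)) has_field_derivative b) (at y)"
    by (simp add: has_field_derivative_def clinear2_def mult_commute_abs)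
  show "partial_x h (x, y) = a" "partial_y h (x, y) = b"
    using 1 2 by (auto simp: partial_x_def partial_y_def DERIV_imp_deriv)
qed

lemma clinear2_has_derivative_partials:
  assumes "(h has_derivative clinear2 a b) (at z)"
  shows "(h has_derivative clinear2 (partial_x h z) (partial_y h z)) (at z)"
  using assms clinear2_partials(3,4)[of h a b "fst z" "snd z"] by simp

lemma holomorphic_germs_derivative:
  assumes "h \<in> holomorphic_germs"
  shows "\<forall>\<^sub>F z in nhds 0. (h has_derivative clinear2 (partial_x h z) (partial_y h z)) (at z)"
  using assms unfolding holomorphic_germs_iff
  by eventually_elim (blast intro: clinear2_has_derivative_partials)

section \<open>Calculus rules for complex gradients\<close>

lemma has_derivative_clinear2_const: "((\<lambda>_. c) has_derivative clinear2 0 0) (at z)"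
  by (auto simp: clinear2_def case_prod_unfold intro!: derivative_eq_intros)

lemma has_derivative_clinear2_add:
  "(h has_derivative clinear2 a b) (at z) \<Longrightarrow> (k has_derivative clinear2 c d) (at z) \<Longrightarrow>
   ((\<lambda>w. h w + k w) has_derivative clinear2 (a + c) (b + d)) (at z)"
  by (auto simp: clinear2_def case_prod_unfold fun_eq_iff algebra_simps intro!: derivative_eq_intros)

lemma has_derivative_clinear2_mult:
  "(h has_derivative clinear2 a b) (at z) \<Longrightarrow> (k has_derivative clinear2 c d) (at z) \<Longrightarrow>
   ((\<lambda>w. h w * k w) has_derivative clinear2 (a * k z + h z * c) (b * k z + h z * d)) (at z)"
  by (auto simp: clinear2_def case_prod_unfold fun_eq_iff algebra_simps intro!: derivative_eq_intros)

lemma has_derivative_clinear2_compose: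
  assumes "((\<lambda>w. fst (\<phi> w)) has_derivative clinear2 a b) (at z)"
    and "((\<lambda>w. snd (\<phi> w)) has_derivative clinear2 c d) (at z)"
    and "(h has_derivative clinear2 p q) (at (\<phi> z))"
  shows "((\<lambda>w. h (\<phi> w)) has_derivative clinear2 (p * a + q * c) (p * b + q * d)) (at z)"
proof -
  have "((\<lambda>w. (fst (\<phi> w), snd (\<phi> w))) has_derivative (\<lambda>u. (clinear2 a b u, clinear2 c d u))) (at z)"
    using assms(1,2) by (rule has_derivative_Pair)
  then have "(\<phi> has_derivative (\<lambda>u. (clinear2 a b u, clinear2 c d u))) (at z)" by simp
  then have "((\<lambda>w. h (\<phi> w)) has_derivative (\<lambda>u. clinear2 p q (clinear2 a b u, clinear2 c d u))) (at z)"
    using assms(3) by (rule has_derivative_compose)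
  then show ?thesis
    by (rule has_derivative_eq_rhs) (auto simp: clinear2_def algebra_simps)
qed

section \<open>Closure properties of germs\<close>

lemma holomorphic_germs_const [simp]: "(\<lambda>_. c) \<in> holomorphic_germs"
  unfolding holomorphic_germs_iff using has_derivative_clinear2_const by (intro always_eventually) blast

lemma holomorphic_germs_fst [simp]: "fst \<in> holomorphic_germs"
proof -
  have "(fst has_derivative clinear2 1 0) (at z)" for z :: "complex \<times> complex"
    by (auto simp: clinear2_def case_prod_unfold intro!: derivative_eq_intros)
  then show ?thesis unfolding holomorphic_germs_iff by (intro always_eventually) blast
qed

lemma holomorphic_germs_snd [simp]: "snd \<in> holomorphic_germs"
proof -
  have "(snd has_derivative clinear2 0 1) (at z)" for z :: "complex \<times> complex"
    by (auto simp: clinear2_def case_prod_unfold intro!: derivative_eq_intros)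
  then show ?thesis unfolding holomorphic_germs_iff by (intro always_eventually) blast
qed

lemma holomorphic_germs_add [intro]:
  "h \<in> holomorphic_germs \<Longrightarrow> k \<in> holomorphic_germs \<Longrightarrow> (\<lambda>z. h z + k z) \<in> holomorphic_germs"
  unfolding holomorphic_germs_iff
  by (elim eventually_rev_mp, intro always_eventually) (blast intro: has_derivative_clinear2_add)

lemma holomorphic_germs_mult [intro]:
  "h \<in> holomorphic_germs \<Longrightarrow> k \<in> holomorphic_germs \<Longrightarrow> (\<lambda>z. h z * k z) \<in> holomorphic_germs"
  unfolding holomorphic_germs_iff
  by (elim eventually_rev_mp, intro always_eventually) (blast intro: has_derivative_clinear2_mult)

lemma holomorphic_germs_power [intro]:
  "h \<in> holomorphic_germs \<Longrightarrow> (\<lambda>z. h z ^ n) \<in> holomorphic_germs"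
  by (induction n) (auto simp: holomorphic_germs_mult)

lemma holomorphic_germs_sum [intro]:
  "(\<And>i. i \<in> I \<Longrightarrow> h i \<in> holomorphic_germs) \<Longrightarrow> (\<lambda>z. \<Sum>i\<in>I. h i z) \<in> holomorphic_germs"
  by (induction I rule: infinite_finite_induct) (auto simp: holomorphic_germs_add)

lemma holomorphic_germs_cmult [intro]:
  "h \<in> holomorphic_germs \<Longrightarrow> (\<lambda>z. c * h z) \<in> holomorphic_germs"
  by (rule holomorphic_germs_mult[OF holomorphic_germs_const])

lemma holomorphic_germs_diff [intro]:
  assumes "h \<in> holomorphic_germs" "k \<in> holomorphic_germs"
  shows "(\<lambda>z. h z - k z) \<in> holomorphic_germs"
  using holomorphic_germs_add[OF assms(1) holomorphic_germs_cmult[OF assms(2), of "- 1"]] by simp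

lemma holomorphic_germs_tendsto:
  assumes "h \<in> holomorphic_germs"
  shows "(h \<longlongrightarrow> h 0) (nhds 0)"
proof -
  have "\<exists>a b. (h has_derivative clinear2 a b) (at 0)"
    using assms unfolding holomorphic_germs_iff by (rule eventually_nhds_x_imp_x)
  then have "continuous (at 0) h" using has_derivative_continuous by blast
  then show ?thesis by (simp add: continuous_at tendsto_at_iff_tendsto_nhds)
qed

text \<open>Eventual statements at the origin can be pulled back along a germ map that fixes it;
  every coordinate change below uses this.\<close>

lemma filterlim_germ_map:
  assumes "(\<lambda>z. fst (\<phi> z)) \<in> holomorphic_germs" "(\<lambda>z. snd (\<phi> z)) \<in> holomorphic_germs" "\<phi> 0 = 0"
  shows "filterlim \<phi> (nhds (0 :: complex \<times> complex)) (nhds 0)"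
  using tendsto_Pair[OF assms(1,2)[THEN holomorphic_germs_tendsto]] assms(3) by (simp add: zero_prod_def)

lemma holomorphic_germs_compose:
  assumes "h \<in> holomorphic_germs"
    and "(\<lambda>z. fst (\<phi> z)) \<in> holomorphic_germs" "(\<lambda>z. snd (\<phi> z)) \<in> holomorphic_germs" "\<phi> 0 = 0"
  shows "(\<lambda>z. h (\<phi> z)) \<in> holomorphic_germs"
proof -
  have "\<forall>\<^sub>F z in nhds 0. \<exists>a b. (h has_derivative clinear2 a b) (at (\<phi> z))"
    using eventually_compose_filterlim[OF assms(1)[unfolded holomorphic_germs_iff] filterlim_germ_map[OF assms(2-4)]] .
  then show ?thesis
    using assms(2,3) unfolding holomorphic_germs_iff
    by eventually_elim (blast intro: has_derivative_clinear2_compose)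
qed

lemma holomorphic_germs_inverse:
  assumes "h \<in> holomorphic_germs" "h 0 \<noteq> 0"
  shows "(\<lambda>z. inverse (h z)) \<in> holomorphic_germs"
proof -
  have "\<forall>\<^sub>F z in nhds 0. h z \<noteq> 0"
    using holomorphic_germs_tendsto[OF assms(1)] assms(2) by (rule tendsto_imp_eventually_ne)
  then show ?thesis
    using assms(1) unfolding holomorphic_germs_iff
  proof eventually_elim
    case (elim z)
    then obtain a b where "(h has_derivative clinear2 a b) (at z)" by blast
    with elim(1) have "((\<lambda>z. inverse (h z)) has_derivative clinear2 (- a / h z ^ 2) (- b / h z ^ 2)) (at z)"
      by (auto simp: clinear2_def case_prod_unfold fun_eq_iff field_simps power2_eq_square
          intro!: derivative_eq_intros)
    then show ?case by blast
  qed
qed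


section \<open>Cauchy integrals in one of two variables\<close>

lemma continuous_on_section:
  assumes "continuous_on (U \<times> T) (\<lambda>(z, t). f z t)" "z \<in> U"
  shows "continuous_on T (f z)"
proof -
  have "continuous_on T (\<lambda>t. (\<lambda>(z, t). f z t) (z, t))"
    by (rule continuous_on_compose2[OF assms(1)]) (use assms(2) in \<open>auto intro!: continuous_intros\<close>)
  then show ?thesis by simp
qed

text \<open>The Leibniz rule yields the integral of the derivatives. This is again complex-linear,
  because maps \<open>clinear2 a b\<close> are integrated coefficient by coefficient.\<close>

lemma holomorphic2_on_parametric_integral:
  fixes f a b :: "complex \<times> complex \<Rightarrow> real \<Rightarrow> complex"
  assumes "open U" "convex U"
    and der: "\<And>z t. z \<in> U \<Longrightarrow> t \<in> {0..1} \<Longrightarrow> ((\<lambda>z. f z t) has_derivative clinear2 (a z t) (b z t)) (at z)"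
    and f: "\<And>z. z \<in> U \<Longrightarrow> continuous_on {0..1} (f z)"
    and a: "continuous_on (U \<times> {0..1}) (\<lambda>(z, t). a z t)"
    and b: "continuous_on (U \<times> {0..1}) (\<lambda>(z, t). b z t)"
  shows "holomorphic2_on (\<lambda>z. integral {0..1} (f z)) U"
proof -
  \<comment> \<open>The derivative as an element of the normed space of bounded linear maps;
    composing with the projections lets continuity of \<open>a\<close> and \<open>b\<close> pass to
    it.\<close>
  define D where "D z t = blinfun_compose (blinfun_mult_right (a z t)) fst_blinfun
     + blinfun_compose (blinfun_mult_right (b z t)) snd_blinfun" for z t
  have D: "blinfun_apply (D z t) = clinear2 (a z t) (b z t)" for z t
    by (auto simp: D_def clinear2_def plus_blinfun.rep_eq blinfun_compose.rep_eq
        fst_blinfun.rep_eq snd_blinfun.rep_eq)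
  have contD: "continuous_on (U \<times> {0..1}) (\<lambda>(z, t). D z t)"
    using a b unfolding D_def case_prod_unfold
    by (auto intro!: continuous_intros bounded_linear.continuous_on[OF bounded_linear_blinfun_mult_right])
  have "\<exists>p q. ((\<lambda>z. integral {0..1} (f z)) has_derivative clinear2 p q) (at z)" if z: "z \<in> U" for z
  proof -
    have "((\<lambda>z. integral (cbox 0 1) (f z)) has_derivative integral (cbox 0 1) (D z)) (at z within U)"
    proof (rule leibniz_rule)
      show "((\<lambda>x. f x t) has_derivative blinfun_apply (D x t)) (at x within U)"
        if "x \<in> U" "t \<in> cbox 0 1" for x t
        using der[of x t] that by (auto simp: D intro: has_derivative_at_withinI)
      show "f x integrable_on cbox 0 1" if "x \<in> U" for x
        using f[OF that] by (auto intro: integrable_continuous_interval)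
    qed (use assms(1,2) contD z in simp_all)
    then have *: "((\<lambda>z. integral {0..1} (f z)) has_derivative integral {0..1} (D z)) (at z)"
      by (simp only: at_within_open[OF z \<open>open U\<close>] box_real)
    have "continuous_on {0..1} (a z)" "continuous_on {0..1} (b z)"
      using continuous_on_section[OF a z] continuous_on_section[OF b z] .
    then have az: "a z integrable_on {0..1}" and bz: "b z integrable_on {0..1}"
      by (auto intro: integrable_continuous_interval)
    have "continuous_on {0..1} (D z)"
      using continuous_on_section[OF contD z] .
    then have Dz: "D z integrable_on {0..1}" by (rule integrable_continuous_interval)
    have "blinfun_apply (integral {0..1} (D z)) = clinear2 (integral {0..1} (a z)) (integral {0..1} (b z))"
    proof
      fix w :: "complex \<times> complex"
      obtain u v where w: "w = (u, v)" by (cases w)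
      have "integral {0..1} (\<lambda>t. a z t * u + b z t * v) = integral {0..1} (a z) * u + integral {0..1} (b z) * v"
        by (subst integral_add) (use az bz in \<open>auto intro!: integrable_on_mult_left\<close>)
      then show "blinfun_apply (integral {0..1} (D z)) w = clinear2 (integral {0..1} (a z)) (integral {0..1} (b z)) w"
        by (subst blinfun_apply_integral[OF Dz]) (simp add: D clinear2_def w)
    qed
    from *[unfolded this] show ?thesis by (intro exI)
  qed
  with \<open>open U\<close> show ?thesis by (simp add: holomorphic2_on_iff)
qed

section \<open>Restriction to discs and exchange of the coordinates\<close>

lemma holomorphic2_on_derivative:
  assumes "holomorphic2_on h S" "z \<in> S"
  shows "(h has_derivative clinear2 (partial_x h z) (partial_y h z)) (at z)"
  using assms unfolding holomorphic2_on_iff by (blast intro: clinear2_has_derivative_partials)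

lemma holomorphic2_on_continuous_on: "holomorphic2_on h S \<Longrightarrow> continuous_on S h"
  by (meson continuous_at_imp_continuous_on has_derivative_continuous holomorphic2_on_derivative)

lemma holomorphic2_on_holomorphic_on:
  assumes "holomorphic2_on h (A \<times> B)" "y \<in> B"
  shows "(\<lambda>s. h (s, y)) holomorphic_on A"
proof (rule holomorphic_onI)
  fix x assume "x \<in> A"
  then have "((\<lambda>s. h (s, y)) has_field_derivative partial_x h (x, y)) (at x)"
    using holomorphic2_on_derivative[OF assms(1), of "(x, y)"] assms(2) by (auto intro: clinear2_partials(1))
  then show "(\<lambda>s. h (s, y)) field_differentiable at x within A"
    by (auto simp: field_differentiable_def intro: has_field_derivative_at_within)
qed

lemma holomorphic2_on_subset: "holomorphic2_on h S \<Longrightarrow> open T \<Longrightarrow> T \<subseteq> S \<Longrightarrow> holomorphic2_on h T"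
  by (auto simp: holomorphic2_on_def)

lemma has_derivative_clinear2_swap:
  assumes "(h has_derivative clinear2 a b) (at (prod.swap z))"
  shows "((\<lambda>w. h (prod.swap w)) has_derivative clinear2 b a) (at z)"
proof -
  have "(snd has_derivative clinear2 0 1) (at z)" "(fst has_derivative clinear2 1 0) (at z)"
    by (auto simp: clinear2_def case_prod_unfold intro!: derivative_eq_intros)
  with has_derivative_clinear2_compose[where \<phi> = prod.swap and z = z and h = h, of 0 1 1 0 a b] assms
  show ?thesis by simp
qed

lemma holomorphic2_on_swap:
  assumes "holomorphic2_on h (A \<times> B)" "open A" "open B"
  shows "holomorphic2_on (\<lambda>z. h (prod.swap z)) (B \<times> A)"
proof -
  have "\<exists>a b. ((\<lambda>z. h (prod.swap z)) has_derivative clinear2 a b) (at z)" if "z \<in> B \<times> A" for z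
  proof -
    have "prod.swap z \<in> A \<times> B" using that by auto
    then have "((\<lambda>z. h (prod.swap z)) has_derivative
        clinear2 (partial_y h (prod.swap z)) (partial_x h (prod.swap z))) (at z)"
      by (intro has_derivative_clinear2_swap holomorphic2_on_derivative[OF assms(1)])
    then show ?thesis by blast
  qed
  with assms(2,3) show ?thesis unfolding holomorphic2_on_iff by (blast intro: open_Times)
qed

lemma partial_y_swap: "partial_y h z = partial_x (\<lambda>w. h (prod.swap w)) (prod.swap z)"
  by (cases z) (simp add: partial_x_def partial_y_def)

lemma holomorphic_germs_swap: "h \<in> holomorphic_germs \<Longrightarrow> (\<lambda>z. h (prod.swap z)) \<in> holomorphic_germs"
  by (rule holomorphic_germs_compose) (simp_all add: zero_prod_def)

text \<open>A Cauchy integral moves one variable along a circle while the other is a parameter, so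
  the domain has to contain a product of discs.\<close>

lemma holomorphic_germs_polydisc:
  assumes "h \<in> holomorphic_germs"
  obtains R where "R > 0" "holomorphic2_on h (ball 0 R \<times> ball 0 R)"
proof -
  obtain S where S: "0 \<in> S" "holomorphic2_on h S" using assms by (auto simp: holomorphic_germs_def)
  then have "open S" by (simp add: holomorphic2_on_def)
  then obtain A B where AB: "open A" "open B" "0 \<in> A \<times> B" "A \<times> B \<subseteq> S"
    using S(1) by (rule open_prod_elim)
  obtain r s where "r > 0" "s > 0" "ball 0 r \<subseteq> A" "ball 0 s \<subseteq> B"
    using AB by (metis mem_Sigma_iff zero_prod_def openE)
  then have "ball 0 (min r s) \<times> ball 0 (min r s) \<subseteq> S" "min r s > 0"
    using AB(4) by (auto simp: subset_iff)
  then show ?thesis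
    using that[of "min r s"] holomorphic2_on_subset[OF S(2)] by (simp add: open_Times)
qed

section \<open>Cauchy's formula with a parameter\<close>

lemma circlepath_in_sphere: "r \<ge> 0 \<Longrightarrow> t \<in> {0..1} \<Longrightarrow> circlepath 0 r t \<in> sphere 0 r"
  using path_image_circlepath[of 0 r] by (force simp: path_image_def)

lemma contour_integral_circlepath:
  "contour_integral (circlepath 0 r) f =
    integral {0..1} (\<lambda>t. f (circlepath 0 r t) * (2 * pi * \<i> * r * exp (2 * pi * \<i> * t)))"
  unfolding contour_integral_integral
  by (intro integral_cong) (simp add: vector_derivative_circlepath)

lemma continuous_on_circlepath [continuous_intros]:
  "continuous_on S f \<Longrightarrow> continuous_on S (\<lambda>x. circlepath z r (f x))"
  unfolding circlepath by (auto intro!: continuous_intros)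

text \<open>Cauchy's formula on the slice with fixed \<open>y\<close>. The circle is the same for
  all \<open>(x, y)\<close>, so regularity in both variables can be read off the integrand.\<close>

lemma partial_x_Cauchy:
  assumes h: "holomorphic2_on h (ball 0 R \<times> ball 0 R)" and r: "0 < r" "r < R"
    and xy: "norm x < r" "norm y < r"
  shows "partial_x h (x, y) = 1 / (2 * of_real pi * \<i>) *
           contour_integral (circlepath 0 r) (\<lambda>w. h (w, y) * (1 / (w - x)^2))"
proof -
  have hol: "(\<lambda>s. h (s, y)) holomorphic_on cball 0 r"
    by (rule holomorphic_on_subset[OF holomorphic2_on_holomorphic_on[OF h]]) (use r xy in auto)
  have "((\<lambda>s. h (s, y)) has_field_derivative 1 / (2 * of_real pi * \<i>) *
      contour_integral (circlepath 0 r) (\<lambda>w. h (w, y) / (w - x)^2)) (at x)"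
    using hol xy
    by (intro Cauchy_derivative_integral_circlepath(2))
      (auto intro: holomorphic_on_subset holomorphic_on_imp_continuous_on)
  then show ?thesis by (simp add: partial_x_def DERIV_imp_deriv)
qed

text \<open>The integrand of the Cauchy integral is jointly continuous in the point and the circle
  parameter, hence so is the integral in the point, although \<open>h\<close> is only assumed to be
  differentiable.\<close>

lemma continuous_on_partial_x:
  assumes h: "holomorphic2_on h (ball 0 R \<times> ball 0 R)"
  shows "continuous_on (ball 0 R \<times> ball 0 R) (partial_x h)"
proof -
  have *: "continuous_on (ball 0 r \<times> ball 0 r) (partial_x h)" if r: "0 < r" "r < R" for r
  proof -
    define F where "F = (\<lambda>(x, y). contour_integral (circlepath 0 r) (\<lambda>w. h (w, y) / (w - x)^2))"
    have "continuous_on (ball 0 r \<times> ball 0 r)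
      (\<lambda>z. integral (cbox 0 1) (\<lambda>t. h (circlepath 0 r t, snd z) / (circlepath 0 r t - fst z)^2 *
         (2 * pi * \<i> * r * exp (2 * pi * \<i> * t))))"
    proof (rule integral_continuous_on_param)
      have "circlepath 0 r t \<noteq> x" if "t \<in> {0..1}" "norm x < r" for t x
        using circlepath_in_sphere[of r t] that r by auto
      moreover have "norm (circlepath 0 r t) < R" if "t \<in> {0..1}" for t
        using circlepath_in_sphere[of r t] that r by auto
      ultimately show "continuous_on ((ball 0 r \<times> ball 0 r) \<times> cbox 0 1)
        (\<lambda>(z, t). h (circlepath 0 r t, snd z) / (circlepath 0 r t - fst z)^2 *
         (2 * pi * \<i> * r * exp (2 * pi * \<i> * t)))"
        unfolding case_prod_unfold using r
        by (intro continuous_intros continuous_on_compose2[OF holomorphic2_on_continuous_on[OF h]])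
          (auto simp: power2_eq_square)
    qed
    then have F: "continuous_on (ball 0 r \<times> ball 0 r) F"
      by (rule continuous_on_eq) (auto simp: F_def contour_integral_circlepath)
    have "partial_x h z = 1 / (2 * of_real pi * \<i>) * F z" if "z \<in> ball 0 r \<times> ball 0 r" for z
      using partial_x_Cauchy[OF h r, of "fst z" "snd z"] that by (auto simp: F_def)
    then show ?thesis
      using continuous_on_mult[OF continuous_on_const F, of "1 / (2 * of_real pi * \<i>)"]
      by (subst continuous_on_cong[OF refl]) simp_all
  qed
  \<comment> \<open>Continuity is local: a radius strictly between the norms of both coordinates and
    \<open>R\<close> puts \<open>z\<close> into a polydisc where the formula applies.\<close>
  have "isCont (partial_x h) z" if z: "z \<in> ball 0 R \<times> ball 0 R" for z
  proof -
    obtain x y where xy: "z = (x, y)" by (cases z)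
    obtain r where "max (norm x) (norm y) < r" "r < R"
      using z xy dense[of "max (norm x) (norm y)" R] by auto
    then have "z \<in> ball 0 r \<times> ball 0 r" "0 < r" using xy norm_ge_zero[of x] by (auto simp del: norm_ge_zero)
    then show ?thesis using *[OF \<open>0 < r\<close> \<open>r < R\<close>]
      by (auto simp: continuous_on_eq_continuous_at open_Times)
  qed
  then show ?thesis by (simp add: continuous_at_imp_continuous_on)
qed

lemma continuous_on_partial_y:
  assumes h: "holomorphic2_on h (ball 0 R \<times> ball 0 R)"
  shows "continuous_on (ball 0 R \<times> ball 0 R) (partial_y h)"
proof -
  have "continuous_on (ball 0 R \<times> ball 0 R) (partial_x (\<lambda>w. h (prod.swap w)))"
    using h by (intro continuous_on_partial_x holomorphic2_on_swap) auto
  then have "continuous_on (ball 0 R \<times> ball 0 R) (\<lambda>z. partial_x (\<lambda>w. h (prod.swap w)) (prod.swap z))"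
    by (rule continuous_on_compose2) (auto simp: prod.swap_def intro!: continuous_intros)
  then show ?thesis by (simp add: partial_y_swap[abs_def])
qed

text \<open>In the integrand \<open>x\<close> occurs only in the kernel and \<open>y\<close> only in
  \<open>h\<close>, so its partials are \<open>h\<close> times \<open>k'\<close> and
  \<open>partial_y h\<close> times \<open>k\<close>. The kernel stays abstract in order to serve
  both the derivative and the difference quotient.\<close>

lemma holomorphic2_on_kernel_integral:
  assumes h: "holomorphic2_on h (ball 0 R \<times> ball 0 R)" and r: "0 < r" "r < R"
    and k: "\<And>w x. w \<in> sphere 0 r \<Longrightarrow> x \<in> ball 0 r \<Longrightarrow> (k w has_field_derivative k' w x) (at x)"
    and contk: "continuous_on (sphere 0 r \<times> ball 0 r) (\<lambda>(w, x). k w x)"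
    and contk': "continuous_on (sphere 0 r \<times> ball 0 r) (\<lambda>(w, x). k' w x)"
  shows "holomorphic2_on (\<lambda>z. contour_integral (circlepath 0 r) (\<lambda>w. h (w, snd z) * k w (fst z)))
          (ball 0 r \<times> ball 0 r)"
proof -
  define c where "c t = circlepath 0 r t" for t
  define e where "e t = 2 * pi * \<i> * r * exp (2 * pi * \<i> * t)" for t
  have c: "c t \<in> sphere 0 r" "norm (c t) < R" if "t \<in> {0..1}" for t
    using circlepath_in_sphere[of r t] that r by (auto simp: c_def)
  have contc: "continuous_on S c" and conte: "continuous_on S e" for S
    unfolding c_def e_def by (auto intro!: continuous_intros)
  define f where "f z t = h (c t, snd z) * k (c t) (fst z) * e t" for z t
  define a where "a z t = h (c t, snd z) * k' (c t) (fst z) * e t" for z t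
  define b where "b z t = partial_y h (c t, snd z) * k (c t) (fst z) * e t" for z t
  let ?U = "ball (0::complex) r \<times> ball (0::complex) r"
  have conth': "continuous_on (?U \<times> {0..1}) (\<lambda>p. g (c (snd p), snd (fst p)))"
    if "continuous_on (ball 0 R \<times> ball 0 R) g" for g
    using r c(2) by (intro continuous_on_compose2[OF that] continuous_intros continuous_on_compose2[OF contc]) auto
  have contk2: "continuous_on (?U \<times> {0..1}) (\<lambda>p. g (c (snd p)) (fst (fst p)))"
    if "continuous_on (sphere 0 r \<times> ball 0 r) (\<lambda>(w, x). g w x)" for g :: "complex \<Rightarrow> complex \<Rightarrow> complex"
  proof -
    have "continuous_on (?U \<times> {0..1}) (\<lambda>p. (\<lambda>(w, x). g w x) (c (snd p), fst (fst p)))"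
      using r c(1) by (intro continuous_on_compose2[OF that] continuous_intros continuous_on_compose2[OF contc]) auto
    then show ?thesis by simp
  qed
  note conts = continuous_on_mult continuous_on_compose2[OF conte] continuous_on_snd continuous_on_id
    contk2[OF contk] contk2[OF contk'] conth'[OF holomorphic2_on_continuous_on[OF h]]
    conth'[OF continuous_on_partial_y[OF h]]
  have contf: "continuous_on (?U \<times> {0..1}) (\<lambda>(z, t). f z t)"
    unfolding f_def case_prod_unfold by (intro conts) auto
  have "holomorphic2_on (\<lambda>z. integral {0..1} (f z)) ?U"
  proof (rule holomorphic2_on_parametric_integral)
    show "open ?U" "convex ?U" by (simp_all add: open_Times convex_Times)
    show "continuous_on {0..1} (f z)" if "z \<in> ?U" for z
      using continuous_on_section[OF contf that] .
    show "continuous_on (?U \<times> {0..1}) (\<lambda>(z, t). a z t)"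
      unfolding a_def case_prod_unfold by (intro conts) auto
    show "continuous_on (?U \<times> {0..1}) (\<lambda>(z, t). b z t)"
      unfolding b_def case_prod_unfold by (intro conts) auto
    show "((\<lambda>z. f z t) has_derivative clinear2 (a z t) (b z t)) (at z)" if z: "z \<in> ?U" and t: "t \<in> {0..1}" for z t
    proof -
      obtain x y where xy: "z = (x, y)" "norm x < r" "norm y < r" using z by auto
      have "(h has_derivative clinear2 (partial_x h (c t, y)) (partial_y h (c t, y))) (at (c t, y))"
        using h c(2)[OF t] xy r by (intro holomorphic2_on_derivative) auto
      then have "((\<lambda>t'. h (c t, t')) has_field_derivative partial_y h (c t, y)) (at y)"
        by (rule clinear2_partials(2))
      moreover have "(k (c t) has_field_derivative k' (c t) x) (at x)"
        using k c(1)[OF t] xy by auto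
      ultimately have "((\<lambda>z. h (c t, snd z)) has_derivative (\<lambda>u. partial_y h (c t, y) * snd u)) (at z)"
        "((\<lambda>z. k (c t) (fst z)) has_derivative (\<lambda>u. k' (c t) x * fst u)) (at z)"
        using has_derivative_compose[OF has_derivative_snd[OF has_derivative_ident], of "\<lambda>t'. h (c t, t')" _ z]
          has_derivative_compose[OF has_derivative_fst[OF has_derivative_ident], of "k (c t)" _ z] xy
        by (auto simp: has_field_derivative_def)
      then have "((\<lambda>z. h (c t, snd z) * k (c t) (fst z)) has_derivative
          (\<lambda>u. h (c t, snd z) * (k' (c t) x * fst u) + partial_y h (c t, y) * snd u * k (c t) (fst z))) (at z)"
        by (rule has_derivative_mult)
      then have "((\<lambda>z. f z t) has_derivative (\<lambda>u. (h (c t, snd z) * (k' (c t) x * fst u)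
          + partial_y h (c t, y) * snd u * k (c t) (fst z)) * e t)) (at z)"
        unfolding f_def by (rule has_derivative_mult_left)
      then show ?thesis
        by (rule has_derivative_eq_rhs)
          (auto simp: a_def b_def clinear2_def xy fun_eq_iff algebra_simps)
    qed
  qed
  then show ?thesis
    by (simp add: contour_integral_circlepath f_def[abs_def] c_def e_def)
qed


section \<open>Division by the coordinates and Taylor coefficients\<close>

text \<open>The kernel \<open>1 / (w - x)^2\<close> of the derivative is itself holomorphic in
  \<open>x\<close> inside the circle.\<close>

lemma holomorphic_germs_partial_x:
  assumes "h \<in> holomorphic_germs"
  shows "partial_x h \<in> holomorphic_germs"
proof -
  obtain R where R: "R > 0" and h: "holomorphic2_on h (ball 0 R \<times> ball 0 R)"
    using assms by (rule holomorphic_germs_polydisc)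
  define r where "r = R / 2"
  have r: "0 < r" "r < R" using R by (auto simp: r_def)
  define G where "G z = contour_integral (circlepath 0 r) (\<lambda>w. h (w, snd z) * (1 / (w - fst z)^2))" for z
  have G: "holomorphic2_on G (ball 0 r \<times> ball 0 r)"
    unfolding G_def
  proof (rule holomorphic2_on_kernel_integral[OF h r, where k' = "\<lambda>w x. 2 / (w - x)^3"])
    show "((\<lambda>x. 1 / (w - x)^2) has_field_derivative 2 / (w - x)^3) (at x)"
      if "w \<in> sphere 0 r" "x \<in> ball 0 r" for w x :: complex
    proof -
      have "w - x \<noteq> 0" using that by auto
      \<comment> \<open>The quotient rule leaves a fourth power in the denominator; one factor
        cancels.\<close>
      moreover have "2 * d / d ^ 4 = 2 / d ^ 3" for d :: complex
        by (simp add: power3_eq_cube power4_eq_xxxx)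
      from this[of "w - x"] have "(2 * w - 2 * x) / (w - x) ^ 4 = 2 / (w - x) ^ 3"
        by (simp only: right_diff_distrib)
      ultimately show ?thesis
        by (auto intro!: derivative_eq_intros)
    qed
    show "continuous_on (sphere 0 r \<times> ball 0 r) (\<lambda>(w, x :: complex). 1 / (w - x)^2)"
      "continuous_on (sphere 0 r \<times> ball 0 r) (\<lambda>(w, x :: complex). 2 / (w - x)^3)"
      by (auto simp: case_prod_unfold intro!: continuous_intros)
  qed
  have G_germ: "(\<lambda>z. 1 / (2 * of_real pi * \<i>) * G z) \<in> holomorphic_germs"
    by (intro holomorphic_germs_cmult holomorphic_germsI[OF G]) (use r in \<open>simp add: zero_prod_def\<close>)
  have "partial_x h z = 1 / (2 * of_real pi * \<i>) * G z" if "z \<in> ball 0 r \<times> ball 0 r" for z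
    using partial_x_Cauchy[OF h r, of "fst z" "snd z"] that by (auto simp: G_def)
  moreover have "\<forall>\<^sub>F z in nhds 0. z \<in> ball 0 r \<times> ball (0::complex) r"
    using r by (intro eventually_nhds_in_open) (auto simp: zero_prod_def open_Times)
  ultimately have "\<forall>\<^sub>F z in nhds 0. 1 / (2 * of_real pi * \<i>) * G z = partial_x h z"
    by (auto elim: eventually_mono)
  then show ?thesis by (rule holomorphic_germs_cong[OF G_germ])
qed

lemma holomorphic_germs_partial_y:
  assumes "h \<in> holomorphic_germs"
  shows "partial_y h \<in> holomorphic_germs"
  using holomorphic_germs_swap[OF holomorphic_germs_partial_x[OF holomorphic_germs_swap[OF assms]]]
  by (simp add: partial_y_swap[abs_def])

text \<open>The removable singularity along \<open>x = 0\<close> is filled in by the derivative. The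
  operator is thus total, and \<open>div_x_expand\<close> is valid at every point for every
  \<open>h\<close>.\<close>

definition div_x :: "(complex \<times> complex \<Rightarrow> complex) \<Rightarrow> complex \<times> complex \<Rightarrow> complex" where
  "div_x h = (\<lambda>(x, y). if x = 0 then deriv (\<lambda>s. h (s, y)) 0 else (h (x, y) - h (0, y)) / x)"

definition div_y :: "(complex \<times> complex \<Rightarrow> complex) \<Rightarrow> complex \<times> complex \<Rightarrow> complex" where
  "div_y h = (\<lambda>z. div_x (\<lambda>w. h (prod.swap w)) (prod.swap z))"

text \<open>Partial fractions, \<open>1 / (w - x) - 1 / w = x / (w * (w - x))\<close>, merge the
  Cauchy integrals for \<open>h (x, y)\<close> and \<open>h (0, y)\<close>. At \<open>x = 0\<close>
  the kernel becomes that of the derivative, so one integral covers both branches of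
  \<open>div_x\<close>.\<close>

lemma div_x_Cauchy:
  assumes h: "holomorphic2_on h (ball 0 R \<times> ball 0 R)" and r: "0 < r" "r < R"
    and xy: "norm x < r" "norm y < r"
  shows "div_x h (x, y) = 1 / (2 * of_real pi * \<i>) *
           contour_integral (circlepath 0 r) (\<lambda>w. h (w, y) * (1 / (w * (w - x))))"
proof (cases "x = 0")
  case True
  then show ?thesis
    using partial_x_Cauchy[OF h r xy] by (simp add: div_x_def partial_x_def power2_eq_square)
next
  case False
  have hol: "(\<lambda>s. h (s, y)) holomorphic_on cball 0 r"
    by (rule holomorphic_on_subset[OF holomorphic2_on_holomorphic_on[OF h]]) (use r xy in auto)
  have "((\<lambda>w. (h (w, y) / (w - x) - h (w, y) / (w - 0)) / x) has_contour_integral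
     (2 * of_real pi * \<i> * h (x, y) - 2 * of_real pi * \<i> * h (0, y)) / x) (circlepath 0 r)"
    by (intro has_contour_integral_div has_contour_integral_diff Cauchy_integral_circlepath_simple[OF hol])
      (use xy r in auto)
  then have "((\<lambda>w. h (w, y) * (1 / (w * (w - x)))) has_contour_integral
     (2 * of_real pi * \<i> * h (x, y) - 2 * of_real pi * \<i> * h (0, y)) / x) (circlepath 0 r)"
  proof (rule has_contour_integral_eq)
    fix w assume "w \<in> path_image (circlepath 0 r)"
    then have "w - x \<noteq> 0" "w \<noteq> 0" using xy r by auto
    moreover from this have "1 / (w - x) - 1 / w = x / (w * (w - x))"
      by (simp add: diff_frac_eq)
    then have "h (w, y) * (1 / (w - x) - 1 / w) / x = h (w, y) * (x / (w * (w - x))) / x" by simp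
    ultimately show "(h (w, y) / (w - x) - h (w, y) / (w - 0)) / x = h (w, y) * (1 / (w * (w - x)))"
      using False by (simp add: right_diff_distrib)
  qed
  with False show ?thesis
    by (simp add: contour_integral_unique div_x_def field_simps)
qed

lemma holomorphic_germs_div_x [intro]:
  assumes "h \<in> holomorphic_germs"
  shows "div_x h \<in> holomorphic_germs"
proof -
  obtain R where R: "R > 0" and h: "holomorphic2_on h (ball 0 R \<times> ball 0 R)"
    using assms by (rule holomorphic_germs_polydisc)
  define r where "r = R / 2"
  have r: "0 < r" "r < R" using R by (auto simp: r_def)
  define G where "G z = contour_integral (circlepath 0 r) (\<lambda>w. h (w, snd z) * (1 / (w * (w - fst z))))" for z
  have G: "holomorphic2_on G (ball 0 r \<times> ball 0 r)"
    unfolding G_def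
  proof (rule holomorphic2_on_kernel_integral[OF h r, where k' = "\<lambda>w x. 1 / (w * (w - x)^2)"])
    show "((\<lambda>x. 1 / (w * (w - x))) has_field_derivative 1 / (w * (w - x)^2)) (at x)"
      if "w \<in> sphere 0 r" "x \<in> ball 0 r" for w x :: complex
    proof -
      have "w - x \<noteq> 0" "w \<noteq> 0" using that r by auto
      then show ?thesis
        by (auto intro!: derivative_eq_intros simp: power2_eq_square)
    qed
    show "continuous_on (sphere 0 r \<times> ball 0 r) (\<lambda>(w, x :: complex). 1 / (w * (w - x)))"
      "continuous_on (sphere 0 r \<times> ball 0 r) (\<lambda>(w, x :: complex). 1 / (w * (w - x)^2))"
      using r by (auto simp: case_prod_unfold intro!: continuous_intros)
  qed
  have G_germ: "(\<lambda>z. 1 / (2 * of_real pi * \<i>) * G z) \<in> holomorphic_germs"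
    by (intro holomorphic_germs_cmult holomorphic_germsI[OF G]) (use r in \<open>simp add: zero_prod_def\<close>)
  have "div_x h z = 1 / (2 * of_real pi * \<i>) * G z" if "z \<in> ball 0 r \<times> ball 0 r" for z
    using div_x_Cauchy[OF h r, of "fst z" "snd z"] that by (auto simp: G_def)
  moreover have "\<forall>\<^sub>F z in nhds 0. z \<in> ball 0 r \<times> ball (0::complex) r"
    using r by (intro eventually_nhds_in_open) (auto simp: zero_prod_def open_Times)
  ultimately have "\<forall>\<^sub>F z in nhds 0. 1 / (2 * of_real pi * \<i>) * G z = div_x h z"
    by (auto elim: eventually_mono)
  then show ?thesis by (rule holomorphic_germs_cong[OF G_germ])
qed

lemma holomorphic_germs_div_y [intro]: "h \<in> holomorphic_germs \<Longrightarrow> div_y h \<in> holomorphic_germs"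
  unfolding div_y_def by (intro holomorphic_germs_swap holomorphic_germs_div_x)

section \<open>Rules for division by a coordinate\<close>

lemma eventually_nhds_0_polydisc:
  "(\<forall>\<^sub>F z in nhds (0 :: complex \<times> complex). P z) \<longleftrightarrow>
   (\<exists>r>0. \<forall>x y. norm x < r \<longrightarrow> norm y < r \<longrightarrow> P (x, y))"
proof
  assume "\<forall>\<^sub>F z in nhds (0 :: complex \<times> complex). P z"
  then obtain A B where "eventually A (nhds 0)" "eventually B (nhds 0)" "\<forall>x y. A x \<longrightarrow> B y \<longrightarrow> P (x, y)"
    by (auto simp: zero_prod_def nhds_prod eventually_prod_filter)
  moreover from this obtain r s where "r > 0" "\<forall>x. norm x < r \<longrightarrow> A x" "s > 0" "\<forall>x. norm x < s \<longrightarrow> B x"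
    by (auto simp: eventually_nhds_metric)
  ultimately show "\<exists>r>0. \<forall>x y. norm x < r \<longrightarrow> norm y < r \<longrightarrow> P (x, y)"
    by (intro exI[of _ "min r s"]) auto
next
  assume "\<exists>r>0. \<forall>x y. norm x < r \<longrightarrow> norm y < r \<longrightarrow> P (x, y)"
  then obtain r where r: "r > 0" "\<forall>x y. norm x < r \<longrightarrow> norm y < r \<longrightarrow> P (x, y)" by blast
  have "\<forall>\<^sub>F z in nhds 0. z \<in> ball 0 r \<times> ball (0::complex) r"
    using r by (intro eventually_nhds_in_open) (auto simp: zero_prod_def open_Times)
  then show "\<forall>\<^sub>F z in nhds (0 :: complex \<times> complex). P z"
    by eventually_elim (use r in auto)
qed

lemma eventually_nhds_0_swap:
  assumes "\<forall>\<^sub>F z in nhds (0 :: complex \<times> complex). P z"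
  shows "\<forall>\<^sub>F z in nhds 0. P (prod.swap z)"
  using assms unfolding eventually_nhds_0_polydisc by auto

text \<open>The value of \<open>div_x h\<close> at \<open>(x, y)\<close> also involves
  \<open>h\<close> at or near \<open>(0, y)\<close>. A polydisc contains that point along with
  \<open>(x, y)\<close>, so agreement as germs is enough.\<close>

lemma div_x_cong:
  assumes "\<forall>\<^sub>F z in nhds 0. h z = k z"
  shows "\<forall>\<^sub>F z in nhds 0. div_x h z = div_x k z"
proof -
  obtain r where r: "r > 0" "\<And>x y. norm x < r \<Longrightarrow> norm y < r \<Longrightarrow> h (x, y) = k (x, y)"
    using assms unfolding eventually_nhds_0_polydisc by blast
  have "div_x h (x, y) = div_x k (x, y)" if "norm x < r" "norm y < r" for x y
  proof -
    have "\<forall>\<^sub>F s in nhds 0. h (s, y) = k (s, y)"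
      using r that by (auto simp: eventually_nhds_metric)
    then have "deriv (\<lambda>s. h (s, y)) 0 = deriv (\<lambda>s. k (s, y)) 0"
      by (rule deriv_cong_ev) simp
    with r that show ?thesis by (simp add: div_x_def)
  qed
  with r(1) show ?thesis unfolding eventually_nhds_0_polydisc by blast
qed

lemma div_y_cong:
  "\<forall>\<^sub>F z in nhds 0. h z = k z \<Longrightarrow> \<forall>\<^sub>F z in nhds 0. div_y h z = div_y k z"
  unfolding div_y_def by (intro eventually_nhds_0_swap div_x_cong)

text \<open>On the line \<open>x = 0\<close> the quotient is a \<open>deriv\<close>, whose sum and
  product rules require differentiable slices; this supplies them.\<close>

lemma holomorphic_germs_field_differentiable:
  assumes "h \<in> holomorphic_germs"
  shows "\<forall>\<^sub>F z :: complex \<times> complex in nhds 0. (\<lambda>s. h (s, snd z)) field_differentiable at 0"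
proof -
  obtain r where r: "r > 0" "\<And>x y. norm x < r \<Longrightarrow> norm y < r \<Longrightarrow>
      (h has_derivative clinear2 (partial_x h (x, y)) (partial_y h (x, y))) (at (x, y))"
    using holomorphic_germs_derivative[OF assms] unfolding eventually_nhds_0_polydisc by blast
  then have "(\<lambda>s. h (s, y)) field_differentiable at 0" if "norm y < r" for y
    using clinear2_partials(1)[OF r(2)[of 0 y]] that by (auto simp: field_differentiable_def)
  with r(1) show ?thesis unfolding eventually_nhds_0_polydisc by (auto intro!: exI[of _ r])
qed

lemma div_x_add:
  assumes "h \<in> holomorphic_germs" "k \<in> holomorphic_germs"
  shows "\<forall>\<^sub>F z in nhds 0. div_x (\<lambda>z. h z + k z) z = div_x h z + div_x k z"
  using assms[THEN holomorphic_germs_field_differentiable]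
  by eventually_elim (auto simp: div_x_def add_divide_distrib[symmetric] case_prod_unfold)

text \<open>On a slice with fixed \<open>y\<close> the factor \<open>g (snd z)\<close> is a
  constant, so \<open>g\<close> can be an arbitrary function.\<close>

lemma div_x_mult_snd:
  assumes "h \<in> holomorphic_germs"
  shows "\<forall>\<^sub>F z in nhds 0. div_x (\<lambda>z. g (snd z) * h z) z = g (snd z) * div_x h z"
  using holomorphic_germs_field_differentiable[OF assms]
  by eventually_elim (auto simp: div_x_def case_prod_unfold right_diff_distrib)

lemma div_x_fst_mult:
  assumes "h \<in> holomorphic_germs"
  shows "\<forall>\<^sub>F z in nhds 0. div_x (\<lambda>z. fst z * h z) z = h z"
  using holomorphic_germs_field_differentiable[OF assms]
  by eventually_elim (auto simp: div_x_def case_prod_unfold)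

lemma div_y_add:
  assumes "h \<in> holomorphic_germs" "k \<in> holomorphic_germs"
  shows "\<forall>\<^sub>F z in nhds 0. div_y (\<lambda>z. h z + k z) z = div_y h z + div_y k z"
  using eventually_nhds_0_swap[OF div_x_add[OF assms[THEN holomorphic_germs_swap]]] by (simp add: div_y_def)

lemma div_y_mult_fst:
  assumes "h \<in> holomorphic_germs"
  shows "\<forall>\<^sub>F z in nhds 0. div_y (\<lambda>z. g (fst z) * h z) z = g (fst z) * div_y h z"
  using eventually_nhds_0_swap[OF div_x_mult_snd[OF holomorphic_germs_swap[OF assms]]] by (simp add: div_y_def)

lemma div_y_snd_mult:
  assumes "h \<in> holomorphic_germs"
  shows "\<forall>\<^sub>F z in nhds 0. div_y (\<lambda>z. snd z * h z) z = h z"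
  using eventually_nhds_0_swap[OF div_x_fst_mult[OF holomorphic_germs_swap[OF assms]]] by (simp add: div_y_def)

lemma div_x_const: "div_x (\<lambda>_. c) = (\<lambda>_. 0)"
  by (auto simp: div_x_def fun_eq_iff)

lemma div_y_const: "div_y (\<lambda>_. c) = (\<lambda>_. 0)"
  by (simp add: div_y_def div_x_const)

lemma div_x_expand: "h (x, y) = h (0, y) + x * div_x h (x, y)"
  by (simp add: div_x_def)

lemma div_y_expand: "h (x, y) = h (x, 0) + y * div_y h (x, y)"
  using div_x_expand[of "\<lambda>w. h (prod.swap w)" y x] by (simp add: div_y_def)

text \<open>The coefficient of \<open>x^i y^j\<close> in the Taylor series. Iterated division avoids
  the factorials of iterated derivatives and turns multiplication by a coordinate into an index
  shift.\<close>

definition taylor :: "nat \<Rightarrow> nat \<Rightarrow> (complex \<times> complex \<Rightarrow> complex) \<Rightarrow> complex" where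
  "taylor i j h = (div_y ^^ j) ((div_x ^^ i) h) 0"

section \<open>Linearity and shift rules for Taylor coefficients\<close>

lemma holomorphic_germs_div_x_funpow [intro]:
  "h \<in> holomorphic_germs \<Longrightarrow> (div_x ^^ i) h \<in> holomorphic_germs"
  by (induction i) auto

lemma holomorphic_germs_div_y_funpow [intro]:
  "h \<in> holomorphic_germs \<Longrightarrow> (div_y ^^ i) h \<in> holomorphic_germs"
  by (induction i) auto

lemma div_x_funpow_cong:
  "\<forall>\<^sub>F z in nhds 0. h z = k z \<Longrightarrow> \<forall>\<^sub>F z in nhds 0. (div_x ^^ i) h z = (div_x ^^ i) k z"
  by (induction i) (auto intro: div_x_cong)

lemma div_y_funpow_cong:
  "\<forall>\<^sub>F z in nhds 0. h z = k z \<Longrightarrow> \<forall>\<^sub>F z in nhds 0. (div_y ^^ i) h z = (div_y ^^ i) k z"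
  by (induction i) (auto intro: div_y_cong)

lemma taylor_cong:
  "\<forall>\<^sub>F z in nhds 0. h z = k z \<Longrightarrow> taylor i j h = taylor i j k"
  unfolding taylor_def by (intro eventually_nhds_x_imp_x[OF div_y_funpow_cong[OF div_x_funpow_cong]])

lemma div_x_funpow_add:
  assumes "h \<in> holomorphic_germs" "k \<in> holomorphic_germs"
  shows "\<forall>\<^sub>F z in nhds 0. (div_x ^^ i) (\<lambda>z. h z + k z) z = (div_x ^^ i) h z + (div_x ^^ i) k z"
proof (induction i)
  case (Suc i)
  show ?case
    using div_x_cong[OF Suc]
      div_x_add[OF assms[THEN holomorphic_germs_div_x_funpow, of i]]
    by eventually_elim simp
qed simp

lemma div_y_funpow_add:
  assumes "h \<in> holomorphic_germs" "k \<in> holomorphic_germs"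
  shows "\<forall>\<^sub>F z in nhds 0. (div_y ^^ i) (\<lambda>z. h z + k z) z = (div_y ^^ i) h z + (div_y ^^ i) k z"
proof (induction i)
  case (Suc i)
  show ?case
    using div_y_cong[OF Suc]
      div_y_add[OF assms[THEN holomorphic_germs_div_y_funpow, of i]]
    by eventually_elim simp
qed simp

lemma div_x_funpow_mult_snd:
  assumes "h \<in> holomorphic_germs"
  shows "\<forall>\<^sub>F z in nhds 0. (div_x ^^ i) (\<lambda>z. g (snd z) * h z) z = g (snd z) * (div_x ^^ i) h z"
proof (induction i)
  case (Suc i)
  show ?case
    using div_x_cong[OF Suc] div_x_mult_snd[OF holomorphic_germs_div_x_funpow[OF assms, of i], of g]
    by eventually_elim simp
qed simp

lemma div_y_funpow_mult_fst:
  assumes "h \<in> holomorphic_germs"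
  shows "\<forall>\<^sub>F z in nhds 0. (div_y ^^ i) (\<lambda>z. g (fst z) * h z) z = g (fst z) * (div_y ^^ i) h z"
proof (induction i)
  case (Suc i)
  show ?case
    using div_y_cong[OF Suc] div_y_mult_fst[OF holomorphic_germs_div_y_funpow[OF assms, of i], of g]
    by eventually_elim simp
qed simp

lemma taylor_add:
  assumes "h \<in> holomorphic_germs" "k \<in> holomorphic_germs"
  shows "taylor i j (\<lambda>z. h z + k z) = taylor i j h + taylor i j k"
  using eventually_nhds_x_imp_x[OF div_y_funpow_cong[OF div_x_funpow_add[OF assms]]]
    eventually_nhds_x_imp_x[OF div_y_funpow_add[OF assms[THEN holomorphic_germs_div_x_funpow]]]
  by (simp add: taylor_def)

lemma taylor_cmult:
  assumes "h \<in> holomorphic_germs"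
  shows "taylor i j (\<lambda>z. c * h z) = c * taylor i j h"
  using eventually_nhds_x_imp_x[OF div_y_funpow_cong[OF div_x_funpow_mult_snd[OF assms, of _ "\<lambda>_. c"]]]
    eventually_nhds_x_imp_x[OF div_y_funpow_mult_fst[OF holomorphic_germs_div_x_funpow[OF assms], of _ "\<lambda>_. c"]]
  by (simp add: taylor_def)

lemma taylor_fst_mult:
  assumes "h \<in> holomorphic_germs"
  shows "taylor i j (\<lambda>z. fst z * h z) = (case i of 0 \<Rightarrow> 0 | Suc i' \<Rightarrow> taylor i' j h)"
proof (cases i)
  case 0
  \<comment> \<open>Without any division by \<open>x\<close>, the factor \<open>x\<close> commutes
    with the divisions by \<open>y\<close> and vanishes at the origin.\<close>
  then show ?thesis
    using eventually_nhds_x_imp_x[OF div_y_funpow_mult_fst[OF assms, of j "\<lambda>x. x"]]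
    by (simp add: taylor_def)
next
  case (Suc i')
  then show ?thesis
    using eventually_nhds_x_imp_x[OF div_y_funpow_cong[OF div_x_funpow_cong[OF div_x_fst_mult[OF assms]]]]
    by (simp add: taylor_def funpow_Suc_right del: funpow.simps)
qed

lemma taylor_snd_mult:
  assumes "h \<in> holomorphic_germs"
  shows "taylor i j (\<lambda>z. snd z * h z) = (case j of 0 \<Rightarrow> 0 | Suc j' \<Rightarrow> taylor i j' h)"
proof -
  \<comment> \<open>The divisions by \<open>x\<close> come first in \<open>taylor\<close>, so the
    factor \<open>y\<close> is moved past them before a division by \<open>y\<close> can cancel
    it.\<close>
  have *: "taylor i j (\<lambda>z. snd z * h z) = (div_y ^^ j) (\<lambda>z. snd z * (div_x ^^ i) h z) 0"
    using eventually_nhds_x_imp_x[OF div_y_funpow_cong[OF div_x_funpow_mult_snd[OF assms, of i "\<lambda>y. y"]]]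
    by (simp add: taylor_def)
  show ?thesis
  proof (cases j)
    case (Suc j')
    then show ?thesis
      using eventually_nhds_x_imp_x[OF div_y_funpow_cong[OF div_y_snd_mult[OF holomorphic_germs_div_x_funpow[OF assms]]]]
      unfolding * by (simp add: taylor_def funpow_Suc_right del: funpow.simps)
  next
    case 0
    then show ?thesis unfolding * by simp
  qed
qed

lemma taylor_fst_power_mult:
  assumes "h \<in> holomorphic_germs"
  shows "taylor i j (\<lambda>z. fst z ^ a * h z) = (if a \<le> i then taylor (i - a) j h else 0)"
proof (induction a arbitrary: i)
  case (Suc a)
  have "taylor i j (\<lambda>z. fst z ^ Suc a * h z) =
      (case i of 0 \<Rightarrow> 0 | Suc i' \<Rightarrow> taylor i' j (\<lambda>z. fst z ^ a * h z))"
    using taylor_fst_mult[OF holomorphic_germs_mult[OF holomorphic_germs_power[OF holomorphic_germs_fst] assms], of i j a]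
    by (simp add: mult.assoc)
  then show ?case by (auto simp: Suc split: nat.splits)
qed simp

lemma taylor_snd_power_mult:
  assumes "h \<in> holomorphic_germs"
  shows "taylor i j (\<lambda>z. snd z ^ a * h z) = (if a \<le> j then taylor i (j - a) h else 0)"
proof (induction a arbitrary: j)
  case (Suc a)
  have "taylor i j (\<lambda>z. snd z ^ Suc a * h z) =
      (case j of 0 \<Rightarrow> 0 | Suc j' \<Rightarrow> taylor i j' (\<lambda>z. snd z ^ a * h z))"
    using taylor_snd_mult[OF holomorphic_germs_mult[OF holomorphic_germs_power[OF holomorphic_germs_snd] assms], of i j a]
    by (simp add: mult.assoc)
  then show ?case by (auto simp: Suc split: nat.splits)
qed simp

lemma taylor_const: "taylor i j (\<lambda>_. c) = (if i = 0 \<and> j = 0 then c else 0)"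
proof -
  have "(div_x ^^ i) (\<lambda>_. c) = (\<lambda>_. if i = 0 then c else 0)" for c
    by (induction i) (auto simp: div_x_const)
  moreover have "(div_y ^^ j) (\<lambda>_. c) = (\<lambda>_. if j = 0 then c else 0)" for c
    by (induction j) (auto simp: div_y_const)
  ultimately show ?thesis by (simp add: taylor_def)
qed

section \<open>Finite expansions with holomorphic remainders\<close>

lemma div_x_funpow_expand:
  "h (x, y) = (\<Sum>i<M. x ^ i * (div_x ^^ i) h (0, y)) + x ^ M * (div_x ^^ M) h (x, y)"
proof (induction M)
  case (Suc M)
  show ?case
    by (subst Suc, subst div_x_expand) (simp add: algebra_simps)
qed simp

lemma div_y_funpow_expand:
  "h (x, y) = (\<Sum>j<N. y ^ j * (div_y ^^ j) h (x, 0)) + y ^ N * (div_y ^^ N) h (x, y)"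
proof (induction N)
  case (Suc N)
  show ?case
    by (subst Suc, subst div_y_expand) (simp add: algebra_simps)
qed simp

text \<open>Expansion in \<open>x\<close> to order \<open>M\<close>, then of each coefficient, a
  function of \<open>y\<close>, to its own order \<open>N i\<close>. Varying row lengths let the sum
  follow the staircase of a monomial basis; the rest is a finite sum of monomials with germ
  coefficients, as ideal membership requires.\<close>

lemma taylor_expansion:
  assumes "h \<in> holomorphic_germs"
  obtains q r where "q \<in> holomorphic_germs" "\<And>i. r i \<in> holomorphic_germs"
    "\<And>x y. h (x, y) = (\<Sum>i<M. \<Sum>j<N i. taylor i j h * x ^ i * y ^ j)
        + (\<Sum>i<M. x ^ i * y ^ N i * r i (x, y)) + x ^ M * q (x, y)"
proof
  \<comment> \<open>The remainder of a row depends on \<open>y\<close> alone; composing with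
    \<open>(0, snd z)\<close> makes it a germ in both variables.\<close>
  define r where "r i = (\<lambda>z :: complex \<times> complex. (div_y ^^ N i) ((div_x ^^ i) h) (0, snd z))" for i
  show "(div_x ^^ M) h \<in> holomorphic_germs" using assms by auto
  show "r i \<in> holomorphic_germs" for i
    unfolding r_def
    by (rule holomorphic_germs_compose[where \<phi> = "\<lambda>z. (0, snd z)"]) (use assms in \<open>auto simp: zero_prod_def\<close>)
  have "x ^ i * (div_x ^^ i) h (0, y) =
      (\<Sum>j<N i. taylor i j h * x ^ i * y ^ j) + x ^ i * y ^ N i * r i (x, y)" for i x y
    using div_y_funpow_expand[of "(div_x ^^ i) h" 0 y "N i"]
    by (simp add: taylor_def r_def zero_prod_def distrib_left sum_distrib_left mult_ac)
  then show "h (x, y) = (\<Sum>i<M. \<Sum>j<N i. taylor i j h * x ^ i * y ^ j)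
        + (\<Sum>i<M. x ^ i * y ^ N i * r i (x, y)) + x ^ M * (div_x ^^ M) h (x, y)" for x y
    by (subst div_x_funpow_expand[of h x y M])
      (simp add: sum.distrib)
qed


section \<open>Tjurina algebras and analytic equivalence\<close>

text \<open>Gaussian elimination by induction on the equations: a zero equation is dropped, any
  other one has a pivot and removes one unknown.\<close>

lemma underdetermined_system:
  fixes a :: "'i \<Rightarrow> 'j \<Rightarrow> 'k::field"
  assumes "finite I" "finite J" "card I < card J"
  shows "\<exists>c. (\<exists>j\<in>J. c j \<noteq> 0) \<and> (\<forall>j. j \<notin> J \<longrightarrow> c j = 0) \<and> (\<forall>i\<in>I. (\<Sum>j\<in>J. a i j * c j) = 0)"
  using assms
proof (induction I arbitrary: J a rule: finite_induct)
  case empty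
  then obtain j where "j \<in> J" by fastforce
  then show ?case by (intro exI[of _ "\<lambda>j'. if j' = j then 1 else 0"]) auto
next
  case (insert i I)
  show ?case
  proof (cases "\<forall>j\<in>J. a i j = 0")
    case True
    have "card I < card J" using insert by simp
    from insert.IH[OF insert.prems(1) this, of a] True show ?thesis by auto
  next
    case False
    then obtain k where k: "k \<in> J" "a i k \<noteq> 0" by blast
    define J' where "J' = J - {k}"
    have J': "finite J'" "card I < card J'" "k \<notin> J'" "J = insert k J'"
      using insert k by (auto simp: J'_def card_Diff_singleton)
    \<comment> \<open>The remaining equations after eliminating the unknown \<open>k\<close> by
      equation \<open>i\<close>.\<close>
    obtain c where c: "\<exists>j\<in>J'. c j \<noteq> 0" "\<forall>j. j \<notin> J' \<longrightarrow> c j = 0"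
      "\<forall>l\<in>I. (\<Sum>j\<in>J'. (a l j - a l k * a i j / a i k) * c j) = 0"
      using insert.IH[OF J'(1,2), of "\<lambda>l j. a l j - a l k * a i j / a i k"] by blast
    \<comment> \<open>Back substitution: this value of the pivot unknown makes equation
      \<open>i\<close> hold.\<close>
    define c' where "c' = c(k := - (\<Sum>j\<in>J'. a i j * c j) / a i k)"
    have sum_c': "(\<Sum>j\<in>J. a l j * c' j) = a l k * c' k + (\<Sum>j\<in>J'. a l j * c j)" for l
    proof -
      have "(\<Sum>j\<in>J'. a l j * c' j) = (\<Sum>j\<in>J'. a l j * c j)"
        using J'(3) by (intro sum.cong) (auto simp: c'_def)
      then show ?thesis using J' by simp
    qed
    have "(\<Sum>j\<in>J. a l j * c' j) = 0" if "l \<in> I" for l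
    proof -
      have "(\<Sum>j\<in>J'. (a l j - a l k * a i j / a i k) * c j)
          = (\<Sum>j\<in>J'. a l j * c j) - a l k / a i k * (\<Sum>j\<in>J'. a i j * c j)"
        unfolding sum_distrib_left sum_subtractf[symmetric]
        by (intro sum.cong) (simp_all add: left_diff_distrib)
      then show ?thesis using c(3) that unfolding sum_c' by (simp add: c'_def)
    qed
    moreover have "(\<Sum>j\<in>J. a i j * c' j) = 0"
      unfolding sum_c' using k by (simp add: c'_def)
    moreover have "\<exists>j\<in>J. c' j \<noteq> 0" "\<forall>j. j \<notin> J \<longrightarrow> c' j = 0"
      using c(1,2) J' by (auto simp: c'_def)
    ultimately show ?thesis by (intro exI[of _ c']) auto
  qed
qed

section \<open>Dimension of a quotient space through dual functionals\<close>

definition function_subspace :: "('a \<Rightarrow> complex) set \<Rightarrow> bool" where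
  "function_subspace V \<longleftrightarrow> (\<lambda>_. 0) \<in> V \<and> (\<forall>h\<in>V. \<forall>k\<in>V. (\<lambda>z. h z + k z) \<in> V) \<and>
     (\<forall>c. \<forall>h\<in>V. (\<lambda>z. c * h z) \<in> V)"

text \<open>\<open>L\<close> induces an isomorphism from \<open>V / W\<close> to the functions on \<open>J\<close>.\<close>

definition quotient_coordinates ::
  "('a \<Rightarrow> complex) set \<Rightarrow> ('a \<Rightarrow> complex) set \<Rightarrow> 'j set \<Rightarrow> ('j \<Rightarrow> ('a \<Rightarrow> complex) \<Rightarrow> complex) \<Rightarrow> bool" where
  "quotient_coordinates V W J L \<longleftrightarrow> finite J \<and>
     (\<forall>j\<in>J. \<forall>h\<in>V. \<forall>k\<in>V. L j (\<lambda>z. h z + k z) = L j h + L j k) \<and>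
     (\<forall>j\<in>J. \<forall>c. \<forall>h\<in>V. L j (\<lambda>z. c * h z) = c * L j h) \<and>
     (\<forall>h\<in>V. h \<in> W \<longleftrightarrow> (\<forall>j\<in>J. L j h = 0)) \<and>
     (\<forall>i\<in>J. \<exists>b\<in>V. \<forall>j\<in>J. L j b = (if j = i then 1 else 0))"

lemma function_subspace_zero: "function_subspace V \<Longrightarrow> (\<lambda>_. 0) \<in> V"
  and function_subspace_add: "function_subspace V \<Longrightarrow> h \<in> V \<Longrightarrow> k \<in> V \<Longrightarrow> (\<lambda>z. h z + k z) \<in> V"
  and function_subspace_cmult: "function_subspace V \<Longrightarrow> h \<in> V \<Longrightarrow> (\<lambda>z. c * h z) \<in> V"
  by (auto simp: function_subspace_def)

lemma quotient_coordinates_add: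
    "quotient_coordinates V W J L \<Longrightarrow> j \<in> J \<Longrightarrow> h \<in> V \<Longrightarrow> k \<in> V \<Longrightarrow>
      L j (\<lambda>z. h z + k z) = L j h + L j k"
  and quotient_coordinates_cmult:
    "quotient_coordinates V W J L \<Longrightarrow> j \<in> J \<Longrightarrow> h \<in> V \<Longrightarrow> L j (\<lambda>z. c * h z) = c * L j h"
  and quotient_coordinates_kernel:
    "quotient_coordinates V W J L \<Longrightarrow> h \<in> V \<Longrightarrow> h \<in> W \<longleftrightarrow> (\<forall>j\<in>J. L j h = 0)"
  by (auto simp: quotient_coordinates_def)

lemma quotient_coordinates_diff:
  assumes V: "function_subspace V" and L: "quotient_coordinates V W J L" and hk: "h \<in> V" "k \<in> V"
  shows "(\<lambda>z. h z - k z) \<in> V" and "j \<in> J \<Longrightarrow> L j (\<lambda>z. h z - k z) = L j h - L j k"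
proof -
  have k: "(\<lambda>w. (-1) * k w) \<in> V" using V hk(2) by (rule function_subspace_cmult)
  show "(\<lambda>z. h z - k z) \<in> V"
    using function_subspace_add[OF V hk(1) k] by simp
  show "L j (\<lambda>z. h z - k z) = L j h - L j k" if j: "j \<in> J"
    using quotient_coordinates_add[OF L j hk(1) k] quotient_coordinates_cmult[OF L j hk(2), of "-1"] by simp
qed

lemma quotient_coordinates_sum:
  assumes V: "function_subspace V" and L: "quotient_coordinates V W J L" and B: "finite B" "B \<subseteq> V"
  shows "(\<lambda>z. \<Sum>b\<in>B. c b * b z) \<in> V"
    and "j \<in> J \<Longrightarrow> L j (\<lambda>z. \<Sum>b\<in>B. c b * b z) = (\<Sum>b\<in>B. c b * L j b)"
proof -
  have "(\<lambda>z. \<Sum>b\<in>B. c b * b z) \<in> V \<and>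
    (\<forall>j\<in>J. L j (\<lambda>z. \<Sum>b\<in>B. c b * b z) = (\<Sum>b\<in>B. c b * L j b))"
    using B
  proof (induction B rule: finite_induct)
    case empty
    have "L j (\<lambda>_. 0) = 0" if "j \<in> J" for j
      using quotient_coordinates_cmult[OF L that function_subspace_zero[OF V], of 0] by simp
    with V show ?case by (simp add: function_subspace_zero)
  next
    case (insert b B)
    then have b: "b \<in> V" "(\<lambda>z. c b * b z) \<in> V" using function_subspace_cmult[OF V] by auto
    have IH: "(\<lambda>z. \<Sum>b\<in>B. c b * b z) \<in> V"
        "\<forall>j\<in>J. L j (\<lambda>z. \<Sum>b\<in>B. c b * b z) = (\<Sum>b\<in>B. c b * L j b)"
      using insert by auto
    show ?case
      using insert.hyps IH(2) function_subspace_add[OF V b(2) IH(1)]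
        quotient_coordinates_add[OF L _ b(2) IH(1)] quotient_coordinates_cmult[OF L _ b(1)]
      by simp
  qed
  then show "(\<lambda>z. \<Sum>b\<in>B. c b * b z) \<in> V"
    and "j \<in> J \<Longrightarrow> L j (\<lambda>z. \<Sum>b\<in>B. c b * b z) = (\<Sum>b\<in>B. c b * L j b)" by auto
qed

text \<open>Functionals with common kernel \<open>W\<close> turn a congruence modulo
  \<open>W\<close> into linear equations indexed by \<open>J\<close>. The definite description in
  \<open>quotient_dim\<close> calls for both a basis of this size and the equality of all basis
  sizes.\<close>

lemma quotient_dim_eq_card:
  assumes V: "function_subspace V" and L: "quotient_coordinates V W J L"
  shows "quotient_dim V W = card J"
proof -
  have "finite J" using L by (simp add: quotient_coordinates_def)
  have mem_iff: "(\<lambda>z. h z - (\<Sum>b\<in>B. c b * b z)) \<in> W \<longleftrightarrow> (\<forall>j\<in>J. L j h = (\<Sum>b\<in>B. c b * L j b))"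
    if "finite B" "B \<subseteq> V" "h \<in> V" for B h c
  proof -
    note sum = quotient_coordinates_sum[OF V L that(1,2), where c = c]
    have "(\<lambda>z. h z - (\<Sum>b\<in>B. c b * b z)) \<in> W \<longleftrightarrow> (\<forall>j\<in>J. L j (\<lambda>z. h z - (\<Sum>b\<in>B. c b * b z)) = 0)"
      by (rule quotient_coordinates_kernel[OF L quotient_coordinates_diff(1)[OF V L that(3) sum(1)]])
    also have "\<dots> \<longleftrightarrow> (\<forall>j\<in>J. L j h = (\<Sum>b\<in>B. c b * L j b))"
      using quotient_coordinates_diff(2)[OF V L that(3) sum(1)] sum(2) by simp
    finally show ?thesis .
  qed
  obtain \<beta> where \<beta>: "\<And>i. i \<in> J \<Longrightarrow> \<beta> i \<in> V" "\<And>i j. i \<in> J \<Longrightarrow> j \<in> J \<Longrightarrow> L j (\<beta> i) = (if j = i then 1 else 0)"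
    using L unfolding quotient_coordinates_def by metis
  have inj: "inj_on \<beta> J"
    by (rule inj_onI) (metis \<beta>(2) zero_neq_one)
  have sum_\<beta>: "(\<Sum>b\<in>\<beta> ` J. c b * L j b) = c (\<beta> j)" if "j \<in> J" for c j
  proof -
    have "(\<Sum>b\<in>\<beta> ` J. c b * L j b) = (\<Sum>i\<in>J. if i = j then c (\<beta> i) else 0)"
      using that by (subst sum.reindex[OF inj]) (auto simp: \<beta>(2) intro!: sum.cong)
    with that \<open>finite J\<close> show ?thesis by simp
  qed
  have basis: "finite_quotient_basis V W (\<beta> ` J)"
    unfolding finite_quotient_basis_def
  proof (intro conjI ballI)
    fix h assume h: "h \<in> V"
    have fin: "finite (\<beta> ` J)" and sub: "\<beta> ` J \<subseteq> V" using \<open>finite J\<close> \<beta>(1) by auto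
    have iff: "(\<lambda>z. h z - (\<Sum>b\<in>\<beta> ` J. c b * b z)) \<in> W \<longleftrightarrow> (\<forall>j\<in>J. L j h = c (\<beta> j))" for c
      unfolding mem_iff[OF fin sub h] by (intro ball_cong refl) (simp only: sum_\<beta>)
    \<comment> \<open>Each coordinate of \<open>h\<close> is attached to the dual element; the value
      0 elsewhere is the normalisation in \<open>finite_quotient_basis\<close>.\<close>
    define c where "c b = (if b \<in> \<beta> ` J then L (inv_into J \<beta> b) h else 0)" for b
    show "\<exists>!c. (\<forall>b. b \<notin> \<beta> ` J \<longrightarrow> c b = 0) \<and> (\<lambda>z. h z - (\<Sum>b\<in>\<beta> ` J. c b * b z)) \<in> W"
      unfolding iff
    proof (rule ex1I[of _ c])
      show "(\<forall>b. b \<notin> \<beta> ` J \<longrightarrow> c b = 0) \<and> (\<forall>j\<in>J. L j h = c (\<beta> j))"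
        by (simp add: c_def inv_into_f_f[OF inj])
      fix c' assume c': "(\<forall>b. b \<notin> \<beta> ` J \<longrightarrow> c' b = 0) \<and> (\<forall>j\<in>J. L j h = c' (\<beta> j))"
      show "c' = c"
      proof
        fix b
        show "c' b = c b"
        proof (cases "b \<in> \<beta> ` J")
          case True
          then obtain j where "j \<in> J" "b = \<beta> j" by blast
          with c' show ?thesis by (simp add: c_def inv_into_f_f[OF inj])
        next
          case False
          then show ?thesis using c' by (simp add: c_def)
        qed
      qed
    qed
  qed (use \<open>finite J\<close> \<beta>(1) in auto)
  have unique: "card B = card J" if "finite_quotient_basis V W B" for B
  proof -
    have B: "finite B" "B \<subseteq> V" using that by (auto simp: finite_quotient_basis_def)
    have ex1: "\<exists>!c. (\<forall>b. b \<notin> B \<longrightarrow> c b = 0) \<and> (\<forall>j\<in>J. L j h = (\<Sum>b\<in>B. c b * L j b))"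
      if "h \<in> V" for h
    proof -
      have "\<exists>!c. (\<forall>b. b \<notin> B \<longrightarrow> c b = 0) \<and> (\<lambda>z. h z - (\<Sum>b\<in>B. c b * b z)) \<in> W"
        using \<open>finite_quotient_basis V W B\<close> that unfolding finite_quotient_basis_def by blast
      then show ?thesis by (simp only: mem_iff[OF B that])
    qed
    \<comment> \<open>More elements than functionals would admit a nontrivial combination lying in
      \<open>W\<close>, a second representation of zero.\<close>
    have "\<not> card J < card B"
    proof
      assume "card J < card B"
      then obtain c where c: "\<exists>b\<in>B. c b \<noteq> 0" "\<forall>b. b \<notin> B \<longrightarrow> c b = 0"
        "\<forall>j\<in>J. (\<Sum>b\<in>B. L j b * c b) = 0"
        using underdetermined_system[OF \<open>finite J\<close> B(1)] by blast
      have 0: "(\<lambda>_. 0) \<in> V" using V by (rule function_subspace_zero)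
      then have "L j (\<lambda>_. 0) = 0" if "j \<in> J" for j
        using quotient_coordinates_diff(2)[OF V L 0 0 that] by simp
      then have "c = (\<lambda>_. 0)"
        using ex1[OF 0] c(2,3) by (auto simp: mult.commute)
      with c(1) show False by simp
    qed
    \<comment> \<open>Fewer elements than functionals would admit a nontrivial combination of
      functionals that vanishes on \<open>B\<close>, hence on everything \<open>B\<close> spans
      modulo \<open>W\<close>; its value at \<open>\<beta> i\<close> is \<open>d i\<close>.\<close>
    moreover have "\<not> card B < card J"
    proof
      assume "card B < card J"
      then obtain d where d: "\<exists>j\<in>J. d j \<noteq> 0" "\<forall>b\<in>B. (\<Sum>j\<in>J. L j b * d j) = 0"
        using underdetermined_system[OF B(1) \<open>finite J\<close>, of "\<lambda>b j. L j b"] by blast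
      have "d i = 0" if i: "i \<in> J" for i
      proof -
        obtain c where c: "\<forall>j\<in>J. L j (\<beta> i) = (\<Sum>b\<in>B. c b * L j b)"
          using ex1[OF \<beta>(1)[OF i]] by blast
        have "d i = (\<Sum>j\<in>J. L j (\<beta> i) * d j)"
          using i \<open>finite J\<close> by (simp add: \<beta>(2) if_distrib[of "\<lambda>x. x * _"] cong: if_cong)
        also have "\<dots> = (\<Sum>j\<in>J. \<Sum>b\<in>B. c b * (L j b * d j))"
          using c by (simp add: sum_distrib_right mult.assoc)
        also have "\<dots> = (\<Sum>b\<in>B. c b * (\<Sum>j\<in>J. L j b * d j))"
          by (subst sum.swap) (simp add: sum_distrib_left)
        also have "\<dots> = 0" using d(2) by simp
        finally show ?thesis .
      qed
      with d(1) show False by blast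
    qed
    ultimately show ?thesis by linarith
  qed
  show ?thesis
    unfolding quotient_dim_def
    using basis unique card_image[OF inj] by (intro the_equality) auto
qed

section \<open>The Tjurina ideal and its transport\<close>

lemma function_subspace_holomorphic_germs: "function_subspace holomorphic_germs"
  by (auto simp: function_subspace_def)

lemmas germ_intros = holomorphic_germs_const holomorphic_germs_fst holomorphic_germs_snd
  holomorphic_germs_add holomorphic_germs_diff holomorphic_germs_mult holomorphic_germs_power

lemma tjurina_ideal_germ: "h \<in> tjurina_ideal f \<Longrightarrow> h \<in> holomorphic_germs"
  by (simp add: tjurina_ideal_def)

lemma mem_tjurina_ideal:
  assumes "h \<in> holomorphic_germs" "a \<in> holomorphic_germs" "b \<in> holomorphic_germs" "c \<in> holomorphic_germs"
    and "\<forall>\<^sub>F z in nhds 0. h z = a z * f z + b z * partial_x f z + c z * partial_y f z"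
  shows "h \<in> tjurina_ideal f"
  unfolding tjurina_ideal_def using assms by (intro CollectI conjI bexI[of _ a] bexI[of _ b] bexI[of _ c])

lemma tjurina_ideal_cong:
  assumes "h \<in> tjurina_ideal f" "\<forall>\<^sub>F z in nhds 0. h z = k z"
  shows "k \<in> tjurina_ideal f"
proof -
  obtain a b c where abc: "a \<in> holomorphic_germs" "b \<in> holomorphic_germs" "c \<in> holomorphic_germs"
    "\<forall>\<^sub>F z in nhds 0. h z = a z * f z + b z * partial_x f z + c z * partial_y f z"
    using assms(1) unfolding tjurina_ideal_def by blast
  have "\<forall>\<^sub>F z in nhds 0. k z = a z * f z + b z * partial_x f z + c z * partial_y f z"
    using abc(4) assms(2) by eventually_elim simp
  moreover have "k \<in> holomorphic_germs"
    using assms holomorphic_germs_cong unfolding tjurina_ideal_def by blast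
  ultimately show ?thesis using abc(1-3) by (intro mem_tjurina_ideal)
qed

text \<open>The normal forms are quasi-homogeneous, so by Euler's relation they lie in the ideal of
  their partials; combinations of the two partials therefore reach the whole ideal.\<close>

lemma tjurina_idealI:
  assumes "h \<in> holomorphic_germs" "a \<in> holomorphic_germs" "b \<in> holomorphic_germs"
    and "\<And>x y. h (x, y) = a (x, y) * partial_x f (x, y) + b (x, y) * partial_y f (x, y)"
  shows "h \<in> tjurina_ideal f"
proof -
  have "h z = 0 * f z + a z * partial_x f z + b z * partial_y f z" for z
    using assms(4)[of "fst z" "snd z"] by simp
  then show ?thesis
    using assms(1-3) by (intro mem_tjurina_ideal[where a = "\<lambda>_. 0" and b = a and c = b] always_eventually) auto
qed

lemma zero_in_tjurina_ideal: "(\<lambda>_. 0) \<in> tjurina_ideal f"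
  by (rule tjurina_idealI[where a = "\<lambda>_. 0" and b = "\<lambda>_. 0"]) auto

text \<open>Product and chain rule express \<open>f\<close> and its partials through
  \<open>g\<close> and its partials at \<open>\<phi> z\<close> with germ coefficients, and
  composition with \<open>\<psi>\<close> removes \<open>\<phi>\<close>. The lemma is applied in both
  directions, with the unit inverted for the second.\<close>

lemma tjurina_ideal_pullback:
  assumes h: "h \<in> tjurina_ideal f" and g: "g \<in> holomorphic_germs" and u: "u \<in> holomorphic_germs"
    and \<phi>: "(\<lambda>z. fst (\<phi> z)) \<in> holomorphic_germs" "(\<lambda>z. snd (\<phi> z)) \<in> holomorphic_germs" "\<phi> 0 = 0"
    and \<psi>: "(\<lambda>z. fst (\<psi> z)) \<in> holomorphic_germs" "(\<lambda>z. snd (\<psi> z)) \<in> holomorphic_germs" "\<psi> 0 = 0"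
    and inverse: "\<forall>\<^sub>F w in nhds 0. \<phi> (\<psi> w) = w"
    and f: "\<forall>\<^sub>F z in nhds 0. f z = u z * g (\<phi> z)"
  shows "(\<lambda>w. h (\<psi> w)) \<in> tjurina_ideal g"
proof -
  \<comment> \<open>The four entries of the Jacobian of \<open>\<phi>\<close>.\<close>
  define p where "p z = partial_x (\<lambda>z. fst (\<phi> z)) z" for z
  define q where "q z = partial_y (\<lambda>z. fst (\<phi> z)) z" for z
  define r where "r z = partial_x (\<lambda>z. snd (\<phi> z)) z" for z
  define s where "s z = partial_y (\<lambda>z. snd (\<phi> z)) z" for z
  have pqrs: "p \<in> holomorphic_germs" "q \<in> holomorphic_germs" "r \<in> holomorphic_germs" "s \<in> holomorphic_germs"
    using \<phi>(1,2)[THEN holomorphic_germs_partial_x] \<phi>(1,2)[THEN holomorphic_germs_partial_y]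
    by (simp_all add: p_def[abs_def] q_def[abs_def] r_def[abs_def] s_def[abs_def])
  have "\<forall>\<^sub>F z in nhds 0. \<forall>\<^sub>F w in nhds z. f w = u w * g (\<phi> w)"
    using f by (simp add: eventually_eventually)
  moreover note eventually_compose_filterlim[OF holomorphic_germs_derivative[OF g] filterlim_germ_map[OF \<phi>]]
  moreover note holomorphic_germs_derivative[OF u] holomorphic_germs_derivative[OF \<phi>(1)]
    holomorphic_germs_derivative[OF \<phi>(2)]
  ultimately have partials: "\<forall>\<^sub>F z in nhds 0. 
      f z = u z * g (\<phi> z) \<and>
      partial_x f z = partial_x u z * g (\<phi> z)
        + u z * (partial_x g (\<phi> z) * p z + partial_y g (\<phi> z) * r z) \<and>
      partial_y f z = partial_y u z * g (\<phi> z)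
        + u z * (partial_x g (\<phi> z) * q z + partial_y g (\<phi> z) * s z)"
  proof eventually_elim
    case (elim z)
    have "((\<lambda>w. u w * g (\<phi> w)) has_derivative clinear2
        (partial_x u z * g (\<phi> z) + u z * (partial_x g (\<phi> z) * p z + partial_y g (\<phi> z) * r z))
        (partial_y u z * g (\<phi> z) + u z * (partial_x g (\<phi> z) * q z + partial_y g (\<phi> z) * s z))) (at z)"
      unfolding p_def q_def r_def s_def
      using has_derivative_clinear2_mult[OF elim(3) has_derivative_clinear2_compose[OF elim(4,5,2)]] .
    then have "(f has_derivative clinear2
        (partial_x u z * g (\<phi> z) + u z * (partial_x g (\<phi> z) * p z + partial_y g (\<phi> z) * r z))
        (partial_y u z * g (\<phi> z) + u z * (partial_x g (\<phi> z) * q z + partial_y g (\<phi> z) * s z))) (at z)"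
      by (rule has_derivative_transform_eventually)
        (use elim(1) in \<open>auto simp: eventually_at_filter elim: eventually_mono dest: eventually_nhds_x_imp_x\<close>)
    then show ?case
      using clinear2_partials(3,4)[of f _ _ "fst z" "snd z"] eventually_nhds_x_imp_x[OF elim(1)] by simp
  qed
  obtain a b c where abc: "a \<in> holomorphic_germs" "b \<in> holomorphic_germs" "c \<in> holomorphic_germs"
    "\<forall>\<^sub>F z in nhds 0. h z = a z * f z + b z * partial_x f z + c z * partial_y f z"
    using h unfolding tjurina_ideal_def by blast
  \<comment> \<open>Coefficients collected at \<open>g\<close> and its two partials; the derivatives
    of the unit contribute only to the first.\<close>
  define A where "A z = a z * u z + b z * partial_x u z + c z * partial_y u z" for z
  define B where "B z = u z * (b z * p z + c z * q z)" for z
  define C where "C z = u z * (b z * r z + c z * s z)" for z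
  have ABC: "A \<in> holomorphic_germs" "B \<in> holomorphic_germs" "C \<in> holomorphic_germs"
    unfolding A_def B_def C_def
    by (intro germ_intros abc pqrs u holomorphic_germs_partial_x holomorphic_germs_partial_y)+
  have "\<forall>\<^sub>F z in nhds 0. h z = A z * g (\<phi> z) + B z * partial_x g (\<phi> z) + C z * partial_y g (\<phi> z)"
    using abc(4) partials by eventually_elim (simp add: A_def B_def C_def algebra_simps)
  then have "\<forall>\<^sub>F w in nhds 0. h (\<psi> w) = A (\<psi> w) * g (\<phi> (\<psi> w)) +
      B (\<psi> w) * partial_x g (\<phi> (\<psi> w)) + C (\<psi> w) * partial_y g (\<phi> (\<psi> w))"
    by (rule eventually_compose_filterlim[OF _ filterlim_germ_map[OF \<psi>]])
  with inverse have "\<forall>\<^sub>F w in nhds 0. h (\<psi> w) = A (\<psi> w) * g w + B (\<psi> w) * partial_x g w + C (\<psi> w) * partial_y g w"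
    by eventually_elim simp
  moreover have "(\<lambda>w. h (\<psi> w)) \<in> holomorphic_germs"
    by (rule holomorphic_germs_compose[OF tjurina_ideal_germ[OF h] \<psi>])
  ultimately show ?thesis
    using ABC[THEN holomorphic_germs_compose, OF \<psi>]
    by (intro mem_tjurina_ideal[where a = "\<lambda>w. A (\<psi> w)" and b = "\<lambda>w. B (\<psi> w)" and c = "\<lambda>w. C (\<psi> w)"])
qed

text \<open>Coordinates for \<open>g\<close>, precomposed with \<open>\<psi>\<close>, are
  coordinates for \<open>f\<close> with the same index set.\<close>

lemma tjurina_number_analytically_equivalent:
  assumes equiv: "analytically_equivalent f g" and g: "g \<in> holomorphic_germs"
    and L: "quotient_coordinates holomorphic_germs (tjurina_ideal g) J L"
  shows "tjurina_number f = card J"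
proof -
  obtain U V \<phi> \<psi> u where U: "0 \<in> U" "\<phi> 0 = 0" "\<phi> ` U = V" "\<psi> ` V = U"
    and inv: "\<forall>z\<in>U. \<psi> (\<phi> z) = z" "\<forall>w\<in>V. \<phi> (\<psi> w) = w"
    and hol: "holomorphic2_on (fst \<circ> \<phi>) U" "holomorphic2_on (snd \<circ> \<phi>) U"
      "holomorphic2_on (fst \<circ> \<psi>) V" "holomorphic2_on (snd \<circ> \<psi>) V" "holomorphic2_on u U"
    and u0: "\<forall>z\<in>U. u z \<noteq> 0" and f: "\<forall>z\<in>U. f z = u z * g (\<phi> z)"
    using equiv unfolding analytically_equivalent_def by blast
  have "open U" "open V" using hol by (auto simp: holomorphic2_on_def)
  have "0 \<in> V" using U by force
  have \<psi>0: "\<psi> 0 = 0" using inv(1) U by force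
  have \<phi>: "(\<lambda>z. fst (\<phi> z)) \<in> holomorphic_germs" "(\<lambda>z. snd (\<phi> z)) \<in> holomorphic_germs"
    using hol(1,2)[THEN holomorphic_germsI] U(1) by (simp_all add: o_def)
  have \<psi>: "(\<lambda>z. fst (\<psi> z)) \<in> holomorphic_germs" "(\<lambda>z. snd (\<psi> z)) \<in> holomorphic_germs"
    using hol(3,4)[THEN holomorphic_germsI] \<open>0 \<in> V\<close> by (simp_all add: o_def)
  have u: "u \<in> holomorphic_germs" using hol(5) U(1) by (rule holomorphic_germsI)
  have evU: "\<forall>\<^sub>F z in nhds 0. z \<in> U" and evV: "\<forall>\<^sub>F w in nhds 0. w \<in> V"
    using \<open>open U\<close> \<open>open V\<close> U(1) \<open>0 \<in> V\<close> by (auto intro: eventually_nhds_in_open)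
  have ev_inv: "\<forall>\<^sub>F z in nhds 0. \<psi> (\<phi> z) = z" "\<forall>\<^sub>F w in nhds 0. \<phi> (\<psi> w) = w"
    using evU evV inv by (auto elim: eventually_mono)
  have ev_f: "\<forall>\<^sub>F z in nhds 0. f z = u z * g (\<phi> z)"
    using evU f by (auto elim: eventually_mono)
  have f_germ: "f \<in> holomorphic_germs"
    by (rule holomorphic_germs_cong[where h = "\<lambda>z. u z * g (\<phi> z)"])
      (use ev_f in \<open>auto intro!: holomorphic_germs_mult u holomorphic_germs_compose[OF g \<phi> U(2)] elim: eventually_mono\<close>)
  \<comment> \<open>The equivalence read backwards, as needed for the reverse inclusion of the
    ideals.\<close>
  have ev_g: "\<forall>\<^sub>F w in nhds 0. g w = inverse (u (\<psi> w)) * f (\<psi> w)"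
    using evV
  proof eventually_elim
    case (elim w)
    then have "\<psi> w \<in> U" using U(4) by blast
    then show ?case using f u0 inv(2) elim by simp
  qed
  have inv_u: "(\<lambda>w. inverse (u (\<psi> w))) \<in> holomorphic_germs"
    using u0 U(1) \<psi>0 by (intro holomorphic_germs_inverse holomorphic_germs_compose[OF u \<psi>]) auto
  have pull: "(\<lambda>w. h (\<psi> w)) \<in> tjurina_ideal g \<longleftrightarrow> h \<in> tjurina_ideal f" if h: "h \<in> holomorphic_germs" for h
  proof
    assume "h \<in> tjurina_ideal f"
    then show "(\<lambda>w. h (\<psi> w)) \<in> tjurina_ideal g"
      using tjurina_ideal_pullback[OF _ g u \<phi> U(2) \<psi> \<psi>0 ev_inv(2) ev_f] by blast
  next
    assume "(\<lambda>w. h (\<psi> w)) \<in> tjurina_ideal g"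
    then have "(\<lambda>z. h (\<psi> (\<phi> z))) \<in> tjurina_ideal f"
      using tjurina_ideal_pullback[OF _ f_germ inv_u \<psi> \<psi>0 \<phi> U(2) ev_inv(1) ev_g] by blast
    then show "h \<in> tjurina_ideal f"
      by (rule tjurina_ideal_cong) (use ev_inv(1) in \<open>auto elim: eventually_mono\<close>)
  qed
  have comp: "(\<lambda>w. h (\<psi> w)) \<in> holomorphic_germs" if "h \<in> holomorphic_germs" for h
    using that \<psi> \<psi>0 by (rule holomorphic_germs_compose)
  \<comment> \<open>\<open>L j\<close> acts on functions, yet it depends only on the germ, since a
    difference that vanishes near 0 lies in the ideal. This is needed for
    \<open>b (\<phi> (\<psi> w))\<close>, which is known to equal \<open>b w\<close> only near the
    origin.\<close>
  have L_cong: "L j h = L j k" if "j \<in> J" "h \<in> holomorphic_germs" "k \<in> holomorphic_germs" "\<forall>\<^sub>F z in nhds 0. h z = k z"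
    for j h k
  proof -
    have "(\<lambda>z. h z - k z) \<in> tjurina_ideal g"
      by (rule tjurina_ideal_cong[OF zero_in_tjurina_ideal]) (use that(4) in \<open>auto elim: eventually_mono\<close>)
    then have "L j (\<lambda>z. h z - k z) = 0"
      using quotient_coordinates_kernel[OF L holomorphic_germs_diff[OF that(2,3)]] that(1) by simp
    then show ?thesis
      using quotient_coordinates_diff(2)[OF function_subspace_holomorphic_germs L that(2,3,1)] by simp
  qed
  have "quotient_coordinates holomorphic_germs (tjurina_ideal f) J (\<lambda>j h. L j (\<lambda>w. h (\<psi> w)))"
    unfolding quotient_coordinates_def
  proof (intro conjI ballI allI)
    show "finite J" using L by (simp add: quotient_coordinates_def)
    show "L j (\<lambda>w. h (\<psi> w) + k (\<psi> w)) = L j (\<lambda>w. h (\<psi> w)) + L j (\<lambda>w. k (\<psi> w))"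
      if "j \<in> J" "h \<in> holomorphic_germs" "k \<in> holomorphic_germs" for j h k
      using quotient_coordinates_add[OF L that(1) comp comp] that(2,3) .
    show "L j (\<lambda>w. c * h (\<psi> w)) = c * L j (\<lambda>w. h (\<psi> w))"
      if "j \<in> J" "h \<in> holomorphic_germs" for j h c
      using quotient_coordinates_cmult[OF L that(1) comp[OF that(2)]] .
    show "h \<in> tjurina_ideal f \<longleftrightarrow> (\<forall>j\<in>J. L j (\<lambda>w. h (\<psi> w)) = 0)" if "h \<in> holomorphic_germs" for h
      using quotient_coordinates_kernel[OF L comp[OF that]] pull[OF that] by simp
    show "\<exists>b\<in>holomorphic_germs. \<forall>j\<in>J. L j (\<lambda>w. b (\<psi> w)) = (if j = i then 1 else 0)" if i: "i \<in> J" for i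
    proof -
      obtain b where b: "b \<in> holomorphic_germs" "\<forall>j\<in>J. L j b = (if j = i then 1 else 0)"
        using L i unfolding quotient_coordinates_def by blast
      have b': "(\<lambda>z. b (\<phi> z)) \<in> holomorphic_germs"
        using b(1) \<phi> U(2) by (rule holomorphic_germs_compose)
      have "L j (\<lambda>w. b (\<phi> (\<psi> w))) = L j b" if "j \<in> J" for j
        using that comp[OF b'] b(1) ev_inv(2) by (intro L_cong) (auto elim: eventually_mono)
      with b(2) b' show ?thesis by (intro bexI[of _ "\<lambda>z. b (\<phi> z)"]) auto
    qed
  qed
  then show ?thesis
    unfolding tjurina_number_def by (rule quotient_dim_eq_card[OF function_subspace_holomorphic_germs])
qed


section \<open>Tjurina numbers of the normal forms\<close>

definition monom2 :: "nat \<Rightarrow> nat \<Rightarrow> complex \<times> complex \<Rightarrow> complex" where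
  "monom2 p q z = fst z ^ p * snd z ^ q"

lemma holomorphic_germs_monom2: "monom2 p q \<in> holomorphic_germs"
  unfolding monom2_def[abs_def] by (intro germ_intros)

lemma taylor_mult_monom2:
  assumes "g \<in> holomorphic_germs"
  shows "taylor i j (\<lambda>z. g z * monom2 p q z) = (if p \<le> i \<and> q \<le> j then taylor (i - p) (j - q) g else 0)"
proof -
  have "(\<lambda>z. g z * monom2 p q z) = (\<lambda>z. fst z ^ p * (snd z ^ q * g z))"
    by (simp add: monom2_def mult_ac)
  then show ?thesis
    using taylor_fst_power_mult[OF holomorphic_germs_mult[OF holomorphic_germs_power[OF holomorphic_germs_snd] assms]]
    by (simp add: taylor_snd_power_mult[OF assms])
qed

lemma taylor_monom2: "taylor i j (monom2 p q) = (if i = p \<and> j = q then 1 else 0)"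
  using taylor_mult_monom2[of "\<lambda>_. 1" i j p q] by (auto simp: taylor_const)

text \<open>All equations and partials of normal forms have at most two terms; a single term is the
  case \<open>d = 0\<close>. Testing a multiple of a generator becomes a comparison of
  exponents.\<close>

lemma taylor_mult_binomial:
  assumes "g \<in> holomorphic_germs" "\<And>x y. P (x, y) = c * x ^ p * y ^ q + d * x ^ r * y ^ s"
  shows "taylor i j (\<lambda>z. g z * P z) =
      c * (if p \<le> i \<and> q \<le> j then taylor (i - p) (j - q) g else 0)
    + d * (if r \<le> i \<and> s \<le> j then taylor (i - r) (j - s) g else 0)"
proof -
  have eq: "(\<lambda>z. g z * P z) = (\<lambda>z. c * (g z * monom2 p q z) + d * (g z * monom2 r s z))"
    by (auto simp: fun_eq_iff assms(2) monom2_def algebra_simps)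
  have *: "(\<lambda>z. g z * monom2 p q z) \<in> holomorphic_germs" for p q
    using assms(1) holomorphic_germs_monom2 by (rule holomorphic_germs_mult)
  show ?thesis
    unfolding eq taylor_add[OF holomorphic_germs_cmult[OF *] holomorphic_germs_cmult[OF *]]
      taylor_cmult[OF *] taylor_mult_monom2[OF assms(1)] ..
qed

text \<open>
  The coordinate of \<open>h\<close> at the basis monomial with exponents \<open>m\<close> is its Taylor coefficient there,
  corrected by the coefficient of the monomial outside the basis that reduces to it.
\<close>

definition reduced_coeff ::
  "(nat \<times> nat \<Rightarrow> complex) \<Rightarrow> (nat \<times> nat \<Rightarrow> nat \<times> nat) \<Rightarrow> nat \<times> nat \<Rightarrow> (complex \<times> complex \<Rightarrow> complex) \<Rightarrow> complex" where
  "reduced_coeff \<kappa> \<sigma> m h =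
     taylor (fst m) (snd m) h - \<kappa> m * taylor (fst (\<sigma> m)) (snd (\<sigma> m)) h"

text \<open>Since \<open>\<sigma> m\<close> lies outside \<open>J\<close>, the correction is zero on
  the basis monomials, which are thus dual to the functionals. What remains is that the ideal and
  the common kernel contain each other: \<open>vanish\<close> and \<open>complete\<close>.\<close>

lemma quotient_coordinates_reduced_coeff:
  assumes J: "finite J" "\<And>m. m \<in> J \<Longrightarrow> \<sigma> m \<notin> J" and f: "f \<in> holomorphic_germs"
    and vanish: "\<And>m g P. m \<in> J \<Longrightarrow> g \<in> holomorphic_germs \<Longrightarrow> P \<in> {f, partial_x f, partial_y f} \<Longrightarrow>
      reduced_coeff \<kappa> \<sigma> m (\<lambda>z. g z * P z) = 0"
    and complete: "\<And>h. h \<in> holomorphic_germs \<Longrightarrow> \<forall>m\<in>J. reduced_coeff \<kappa> \<sigma> m h = 0 \<Longrightarrow> h \<in> tjurina_ideal f"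
  shows "quotient_coordinates holomorphic_germs (tjurina_ideal f) J (reduced_coeff \<kappa> \<sigma>)"
  unfolding quotient_coordinates_def
proof (intro conjI ballI allI)
  show add: "reduced_coeff \<kappa> \<sigma> m (\<lambda>z. h z + k z) = reduced_coeff \<kappa> \<sigma> m h + reduced_coeff \<kappa> \<sigma> m k"
    if "h \<in> holomorphic_germs" "k \<in> holomorphic_germs" for m h k
    by (simp add: reduced_coeff_def taylor_add[OF that] algebra_simps)
  show "reduced_coeff \<kappa> \<sigma> m (\<lambda>z. c * h z) = c * reduced_coeff \<kappa> \<sigma> m h"
    if "h \<in> holomorphic_germs" for m c h
    by (simp add: reduced_coeff_def taylor_cmult[OF that] algebra_simps)
  show "\<exists>b\<in>holomorphic_germs. \<forall>j\<in>J. reduced_coeff \<kappa> \<sigma> j b = (if j = i then 1 else 0)" if "i \<in> J" for i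
  proof (intro bexI[of _ "monom2 (fst i) (snd i)"] ballI holomorphic_germs_monom2)
    fix j assume j: "j \<in> J"
    then have "\<sigma> j \<noteq> i" using J(2) that by blast
    then show "reduced_coeff \<kappa> \<sigma> j (monom2 (fst i) (snd i)) = (if j = i then 1 else 0)"
      by (auto simp: reduced_coeff_def taylor_monom2 prod_eq_iff)
  qed
  show "h \<in> tjurina_ideal f \<longleftrightarrow> (\<forall>m\<in>J. reduced_coeff \<kappa> \<sigma> m h = 0)" if "h \<in> holomorphic_germs" for h
  proof
    assume "h \<in> tjurina_ideal f"
    then obtain a b c where abc: "a \<in> holomorphic_germs" "b \<in> holomorphic_germs" "c \<in> holomorphic_germs"
      and h: "\<forall>\<^sub>F z in nhds 0. h z = a z * f z + b z * partial_x f z + c z * partial_y f z"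
      unfolding tjurina_ideal_def by blast
    have germs: "(\<lambda>z. a z * f z) \<in> holomorphic_germs" "(\<lambda>z. b z * partial_x f z) \<in> holomorphic_germs"
      "(\<lambda>z. c z * partial_y f z) \<in> holomorphic_germs"
      by (intro holomorphic_germs_mult abc f holomorphic_germs_partial_x holomorphic_germs_partial_y)+
    show "\<forall>m\<in>J. reduced_coeff \<kappa> \<sigma> m h = 0"
    proof
      fix m assume m: "m \<in> J"
      have "reduced_coeff \<kappa> \<sigma> m h = reduced_coeff \<kappa> \<sigma> m (\<lambda>z. a z * f z + b z * partial_x f z + c z * partial_y f z)"
        unfolding reduced_coeff_def taylor_cong[OF h] ..
      also have "\<dots> = 0"
        unfolding add[OF holomorphic_germs_add[OF germs(1,2)] germs(3)] add[OF germs(1,2)]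
        using vanish[OF m abc(1), of f] vanish[OF m abc(2), of "partial_x f"]
          vanish[OF m abc(3), of "partial_y f"] by simp
      finally show "reduced_coeff \<kappa> \<sigma> m h = 0" .
    qed
  qed (rule complete[OF that])
qed (rule J)

section \<open>Partials and germs of the normal forms\<close>

lemma normal_form_Dk_partials:
  "partial_x (normal_form (Dk k)) (x, y) = 2 * x * y"
  "partial_y (normal_form (Dk k)) (x, y) = x ^ 2 + of_nat (k - 1) * y ^ (k - 2)"
proof -
  have "((\<lambda>s. s ^ 2 * y + y ^ (k - 1)) has_field_derivative 2 * x * y) (at x)"
    by (auto intro!: derivative_eq_intros)
  then show "partial_x (normal_form (Dk k)) (x, y) = 2 * x * y"
    by (simp add: partial_x_def DERIV_imp_deriv)
  have "((\<lambda>t. x ^ 2 * t + t ^ (k - 1)) has_field_derivative x ^ 2 + of_nat (k - 1) * y ^ (k - 2)) (at y)"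
    by (auto intro!: derivative_eq_intros simp: numeral_2_eq_2)
  then show "partial_y (normal_form (Dk k)) (x, y) = x ^ 2 + of_nat (k - 1) * y ^ (k - 2)"
    by (simp add: partial_y_def DERIV_imp_deriv)
qed

lemma normal_form_E7_partials:
  "partial_x (normal_form E7) (x, y) = 3 * x ^ 2 + y ^ 3"
  "partial_y (normal_form E7) (x, y) = 3 * x * y ^ 2"
proof -
  have "((\<lambda>s. s ^ 3 + s * y ^ 3) has_field_derivative 3 * x ^ 2 + y ^ 3) (at x)"
    by (auto intro!: derivative_eq_intros)
  then show "partial_x (normal_form E7) (x, y) = 3 * x ^ 2 + y ^ 3"
    by (simp add: partial_x_def DERIV_imp_deriv)
  have "((\<lambda>t. x ^ 3 + x * t ^ 3) has_field_derivative 3 * x * y ^ 2) (at y)"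
    by (auto intro!: derivative_eq_intros)
  then show "partial_y (normal_form E7) (x, y) = 3 * x * y ^ 2"
    by (simp add: partial_y_def DERIV_imp_deriv)
qed

lemma holomorphic_germs_normal_form: "normal_form T \<in> holomorphic_germs"
proof (cases T)
  case (Ak k)
  have "normal_form T = (\<lambda>z. fst z ^ 2 + snd z ^ (k + 1))" by (auto simp: Ak fun_eq_iff)
  then show ?thesis by (simp only: germ_intros)
next
  case (Dk k)
  have "normal_form T = (\<lambda>z. fst z ^ 2 * snd z + snd z ^ (k - 1))" by (auto simp: Dk fun_eq_iff)
  then show ?thesis by (simp only: germ_intros)
next
  case E6
  have "normal_form T = (\<lambda>z. fst z ^ 3 + snd z ^ 4)" by (auto simp: E6 fun_eq_iff)
  then show ?thesis by (simp only: germ_intros)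
next
  case E7
  have "normal_form T = (\<lambda>z. fst z ^ 3 + fst z * snd z ^ 3)" by (auto simp: E7 fun_eq_iff)
  then show ?thesis by (simp only: germ_intros)
next
  case E8
  have "normal_form T = (\<lambda>z. fst z ^ 3 + snd z ^ 5)" by (auto simp: E8 fun_eq_iff)
  then show ?thesis by (simp only: germ_intros)
qed

text \<open>This covers the types \<open>A\<^sub>k\<close>, \<open>E\<^sub>6\<close> and \<open>E\<^sub>8\<close>.\<close>

lemma quotient_coordinates_Brieskorn:
  assumes f_def: "f = (\<lambda>(x, y). x ^ Suc M + y ^ Suc N)"
  shows "quotient_coordinates holomorphic_germs (tjurina_ideal f)
     ({..<M} \<times> {..<N}) (reduced_coeff (\<lambda>_. 0) (\<lambda>_. (M, 0)))"
proof (rule quotient_coordinates_reduced_coeff)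
  have partials: "partial_x f (x, y) = of_nat (Suc M) * x ^ M" "partial_y f (x, y) = of_nat (Suc N) * y ^ N" for x y
    using DERIV_add[OF DERIV_power_Suc[OF DERIV_ident, of M x UNIV] DERIV_const[of "y ^ Suc N"]]
      DERIV_add[OF DERIV_const[of "x ^ Suc M"] DERIV_power_Suc[OF DERIV_ident, of N y UNIV]]
    by (auto simp: partial_x_def partial_y_def f_def simp del: power_Suc dest!: DERIV_imp_deriv)
  {
    \<comment> \<open>With correction factor 0 the index \<open>(M, 0)\<close> only has to avoid the
      rectangle. Every term of a generator is divisible by \<open>x^M\<close> or \<open>y^N\<close>,
      so its multiples have no coefficient inside.\<close>
    fix m g P assume m: "m \<in> {..<M} \<times> {..<N}" and g: "g \<in> holomorphic_germs"
      and "P \<in> {f, partial_x f, partial_y f}"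
    then consider "P = f" | "P = partial_x f" | "P = partial_y f" by blast
    then show "reduced_coeff (\<lambda>_. 0) (\<lambda>_. (M, 0)) m (\<lambda>z. g z * P z) = 0"
    proof cases
      case 1
      show ?thesis using m unfolding reduced_coeff_def
        by (subst taylor_mult_binomial[OF g, of P 1 "Suc M" 0 1 0 "Suc N"]) (auto simp: 1 f_def)
    next
      case 2
      show ?thesis using m unfolding reduced_coeff_def
        by (subst taylor_mult_binomial[OF g, of P "of_nat (Suc M)" M 0 0 0 0]) (auto simp: 2 partials)
    next
      case 3
      show ?thesis using m unfolding reduced_coeff_def
        by (subst taylor_mult_binomial[OF g, of P "of_nat (Suc N)" 0 N 0 0 0]) (auto simp: 3 partials)
    qed
  next
    fix h assume h: "h \<in> holomorphic_germs"
      and zero: "\<forall>m\<in>{..<M} \<times> {..<N}. reduced_coeff (\<lambda>_. 0) (\<lambda>_. (M, 0)) m h = 0"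
    obtain q r where qr: "q \<in> holomorphic_germs" "\<And>i. r i \<in> holomorphic_germs"
      and expand: "\<And>x y. h (x, y) = (\<Sum>i<M. \<Sum>j<N. taylor i j h * x ^ i * y ^ j)
          + (\<Sum>i<M. x ^ i * y ^ N * r i (x, y)) + x ^ M * q (x, y)"
      using taylor_expansion[OF h, where M = M and N = "\<lambda>_. N"] by blast
    \<comment> \<open>What survives is a combination of \<open>x^M\<close> and \<open>y^N\<close>,
      the two partials up to nonzero constants.\<close>
    have expand: "h (x, y) = y ^ N * (\<Sum>i<M. x ^ i * r i (x, y)) + x ^ M * q (x, y)" for x y
      using zero by (subst expand) (simp add: reduced_coeff_def sum_distrib_left mult_ac)
    show "h \<in> tjurina_ideal f"
    proof (rule tjurina_idealI[OF h])
      let ?a = "\<lambda>z. 1 / of_nat (Suc M) * q z"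
      let ?b = "\<lambda>z. 1 / of_nat (Suc N) * (\<Sum>i<M. fst z ^ i * r i z)"
      show "?a \<in> holomorphic_germs" "?b \<in> holomorphic_germs"
        by (intro germ_intros holomorphic_germs_sum qr)+
      have nz: "of_nat (Suc M) \<noteq> (0 :: complex)" "of_nat (Suc N) \<noteq> (0 :: complex)"
        by (rule of_nat_neq_0)+
      show "h (x, y) = ?a (x, y) * partial_x f (x, y) + ?b (x, y) * partial_y f (x, y)" for x y
        unfolding partials expand using nz by (simp add: mult_ac del: of_nat_Suc)
    qed
  }
  have "f = (\<lambda>z. fst z ^ Suc M + snd z ^ Suc N)" by (auto simp: f_def)
  then show "f \<in> holomorphic_germs" by (simp only: germ_intros)
qed auto

lemma normal_form_Brieskorn:
  "normal_form (Ak k) = (\<lambda>(x, y). x ^ Suc 1 + y ^ Suc k)"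
  "normal_form E6 = (\<lambda>(x, y). x ^ Suc 2 + y ^ Suc 3)"
  "normal_form E8 = (\<lambda>(x, y). x ^ Suc 2 + y ^ Suc 4)"
  by (auto simp: fun_eq_iff eval_nat_numeral)

text \<open>Write \<open>f_x = 2 x y\<close> and \<open>f_y = x^2 + (k - 1) y^(k - 2)\<close>.
  Modulo the ideal \<open>x^2\<close> equals \<open>-(k - 1) y^(k - 2)\<close>, which is the
  correction at \<open>(0, k - 2)\<close>. Moreover
  \<open>y f_y - x f_x / 2 = (k - 1) y^(k - 1)\<close>, so the powers of \<open>y\<close> stop at
  \<open>k - 2\<close>, and \<open>x\<close> is the only other basis monomial.\<close>

lemma quotient_coordinates_Dk:
  assumes k: "k \<ge> 4"
  shows "quotient_coordinates holomorphic_germs (tjurina_ideal (normal_form (Dk k)))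
     (insert (1, 0) ({0} \<times> {..<k - 1}))
     (reduced_coeff (\<lambda>m. if m = (0, k - 2) then of_nat (k - 1) else 0) (\<lambda>_. (2, 0)))"
    (is "quotient_coordinates _ _ ?J (reduced_coeff ?\<kappa> ?\<sigma>)")
proof (rule quotient_coordinates_reduced_coeff)
  fix m g P assume m: "m \<in> ?J" and g: "g \<in> holomorphic_germs"
    and "P \<in> {normal_form (Dk k), partial_x (normal_form (Dk k)), partial_y (normal_form (Dk k))}"
  then consider "P = normal_form (Dk k)" | "P = partial_x (normal_form (Dk k))" | "P = partial_y (normal_form (Dk k))"
    by blast
  then show "reduced_coeff ?\<kappa> ?\<sigma> m (\<lambda>z. g z * P z) = 0"
  proof cases
    case 1
    show ?thesis using m k unfolding reduced_coeff_def
      by (subst (1 2) taylor_mult_binomial[OF g, of P 1 2 1 1 0 "k - 1"]) (auto simp: 1)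
  next
    case 2
    show ?thesis using m k unfolding reduced_coeff_def
      by (subst (1 2) taylor_mult_binomial[OF g, of P 2 1 1 0 0 0]) (auto simp: 2 normal_form_Dk_partials)
  next
    case 3
    show ?thesis using m k unfolding reduced_coeff_def
      by (subst (1 2) taylor_mult_binomial[OF g, of P 1 2 0 "of_nat (k - 1)" 0 "k - 2"])
        (auto simp: 3 normal_form_Dk_partials)
  qed
next
  fix h assume h: "h \<in> holomorphic_germs" and zero: "\<forall>m\<in>?J. reduced_coeff ?\<kappa> ?\<sigma> m h = 0"
  \<comment> \<open>Rows 1 and 2 keep one term, as \<open>x y\<close> is in the ideal; row 2 is
    present because the coefficient of \<open>x^2\<close> enters the correction.\<close>
  define N :: "nat \<Rightarrow> nat" where "N i = (if i = 0 then k - 1 else 1)" for i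
  obtain q r where qr: "q \<in> holomorphic_germs" "\<And>i. r i \<in> holomorphic_germs"
    and expand: "\<And>x y. h (x, y) = (\<Sum>i<3. \<Sum>j<N i. taylor i j h * x ^ i * y ^ j)
        + (\<Sum>i<3. x ^ i * y ^ N i * r i (x, y)) + x ^ 3 * q (x, y)"
    using taylor_expansion[OF h, where M = 3 and N = N] by blast
  \<comment> \<open>With \<open>k = l + 3\<close> the exponents \<open>k - 1\<close> and
    \<open>k - 2\<close> become \<open>l + 2\<close> and \<open>l + 1\<close>, free of truncated
    subtraction.\<close>
  obtain l where l: "k = Suc (Suc (Suc l))" using k by (intro that[of "k - 3"]) simp
  have t: "taylor 1 0 h = 0" "\<And>j. j < Suc l \<Longrightarrow> taylor 0 j h = 0"
    "taylor 0 (Suc l) h = of_nat (Suc (Suc l)) * taylor 2 0 h"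
    using zero[rule_format, of "(1, 0)"] zero[rule_format, of "(0, _)"] l
    by (simp_all add: reduced_coeff_def)
  have sums: "(\<Sum>i<3. F i) = F 0 + F 1 + F 2" "(\<Sum>i<1. F i) = F 0" for F :: "nat \<Rightarrow> complex"
    by (simp_all add: eval_nat_numeral)
  have expand: "h (x, y) = of_nat (Suc (Suc l)) * taylor 2 0 h * y ^ Suc l + taylor 2 0 h * x ^ 2
      + y ^ Suc (Suc l) * r 0 (x, y) + x * y * r 1 (x, y) + x ^ 2 * y * r 2 (x, y) + x ^ 3 * q (x, y)" for x y
    by (subst expand) (simp add: N_def l t sums del: power_Suc of_nat_Suc One_nat_def)
  have nz: "of_nat (Suc (Suc l)) \<noteq> (0 :: complex)" by (rule of_nat_neq_0)
  show "h \<in> tjurina_ideal (normal_form (Dk k))"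
  proof (rule tjurina_idealI[OF h])
    \<comment> \<open>The witnesses come from \<open>x y = f_x / 2\<close> and
      \<open>c y^(l + 1) = f_y - x^2\<close>: the latter rewrites the term with \<open>r 0\<close>,
      and solved for \<open>x^2\<close> the term with \<open>q\<close>. Both leave a multiple of
      \<open>x y\<close>.\<close>
    let ?c = "of_nat (Suc (Suc l)) :: complex"
    let ?a = "\<lambda>z. - 1 / (2 * ?c) * (fst z * r 0 z) + 1 / 2 * r 1 z + 1 / 2 * (fst z * r 2 z)
        - ?c / 2 * (snd z ^ l * q z)"
    let ?b = "\<lambda>z. taylor 2 0 h + 1 / ?c * (snd z * r 0 z) + fst z * q z"
    show "?a \<in> holomorphic_germs" "?b \<in> holomorphic_germs" by (intro germ_intros qr)+
    show "h (x, y) = ?a (x, y) * partial_x (normal_form (Dk k)) (x, y)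
        + ?b (x, y) * partial_y (normal_form (Dk k)) (x, y)" for x y
      unfolding normal_form_Dk_partials expand using nz
      by (simp add: l field_simps power2_eq_square power3_eq_cube del: of_nat_Suc)
  qed
qed (auto intro: holomorphic_germs_normal_form)

text \<open>Write \<open>f_x = 3 x^2 + y^3\<close> and \<open>f_y = 3 x y^2\<close>. Modulo the
  ideal \<open>x^2\<close> is \<open>-y^3 / 3\<close> and \<open>x^2 y\<close> is
  \<open>-y^4 / 3\<close>, which gives the factor \<open>1 / 3\<close> and the indices
  \<open>(2, 0)\<close> and \<open>(2, 1)\<close>. The powers of \<open>y\<close> stop at 4 because
  \<open>y^2 f_x - x f_y = y^5\<close>.\<close>

lemma quotient_coordinates_E7:
  "quotient_coordinates holomorphic_germs (tjurina_ideal (normal_form E7))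
     ({0} \<times> {..<5} \<union> {1} \<times> {..<2})
     (reduced_coeff (\<lambda>m. if m \<in> {(0, 3), (0, 4)} then 1 / 3 else 0) (\<lambda>m. (2, snd m - 3)))"
    (is "quotient_coordinates _ _ ?J (reduced_coeff ?\<kappa> ?\<sigma>)")
proof (rule quotient_coordinates_reduced_coeff)
  fix m g P assume m: "m \<in> ?J" and g: "g \<in> holomorphic_germs"
    and "P \<in> {normal_form E7, partial_x (normal_form E7), partial_y (normal_form E7)}"
  then consider "P = normal_form E7" | "P = partial_x (normal_form E7)" | "P = partial_y (normal_form E7)"
    by blast
  then show "reduced_coeff ?\<kappa> ?\<sigma> m (\<lambda>z. g z * P z) = 0"
  proof cases
    case 1
    show ?thesis using m unfolding reduced_coeff_def
      by (subst (1 2) taylor_mult_binomial[OF g, of P 1 3 0 1 1 3]) (auto simp: 1)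
  next
    case 2
    show ?thesis using m unfolding reduced_coeff_def
      by (subst (1 2) taylor_mult_binomial[OF g, of P 3 2 0 1 0 3]) (auto simp: 2 normal_form_E7_partials)
  next
    case 3
    show ?thesis using m unfolding reduced_coeff_def
      by (subst (1 2) taylor_mult_binomial[OF g, of P 3 1 2 0 0 0]) (auto simp: 3 normal_form_E7_partials)
  qed
next
  fix h assume h: "h \<in> holomorphic_germs" and zero: "\<forall>m\<in>?J. reduced_coeff ?\<kappa> ?\<sigma> m h = 0"
  \<comment> \<open>Row 1 is cut at \<open>x y^2\<close>, a multiple of \<open>f_y\<close>; row 2
    keeps \<open>x^2\<close> and \<open>x^2 y\<close>, whose coefficients enter the
    corrections.\<close>
  define N :: "nat \<Rightarrow> nat" where "N i = (if i = 0 then 5 else 2)" for i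
  obtain q r where qr: "q \<in> holomorphic_germs" "\<And>i. r i \<in> holomorphic_germs"
    and expand: "\<And>x y. h (x, y) = (\<Sum>i<3. \<Sum>j<N i. taylor i j h * x ^ i * y ^ j)
        + (\<Sum>i<3. x ^ i * y ^ N i * r i (x, y)) + x ^ 3 * q (x, y)"
    using taylor_expansion[OF h, where M = 3 and N = N] by blast
  have zero': "reduced_coeff ?\<kappa> ?\<sigma> (i, j) h = 0" if "(i, j) \<in> ?J" for i j
    using zero that by blast
  have t: "taylor 0 0 h = 0" "taylor 0 1 h = 0" "taylor 0 2 h = 0" "taylor 1 0 h = 0" "taylor 1 1 h = 0"
    "taylor 0 3 h = taylor 2 0 h / 3" "taylor 0 4 h = taylor 2 1 h / 3"
    using zero'[of 0 0] zero'[of 0 1] zero'[of 0 2] zero'[of 1 0] zero'[of 1 1] zero'[of 0 3] zero'[of 0 4]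
    by (simp_all add: reduced_coeff_def)
  have sums: "(\<Sum>j<5. F j) = F 0 + F 1 + F 2 + F 3 + F 4" "(\<Sum>j<2. F j) = F 0 + F 1"
    "(\<Sum>j<3. F j) = F 0 + F 1 + F 2" for F :: "nat \<Rightarrow> complex"
    by (simp_all add: eval_nat_numeral)
  have expand: "h (x, y) = taylor 2 0 h / 3 * (3 * x ^ 2 + y ^ 3) + taylor 2 1 h / 3 * y * (3 * x ^ 2 + y ^ 3)
      + y ^ 5 * r 0 (x, y) + x * y ^ 2 * r 1 (x, y) + x ^ 2 * y ^ 2 * r 2 (x, y) + x ^ 3 * q (x, y)" for x y
  proof -
    have "y ^ 4 = y * y ^ 3" by (simp add: eval_nat_numeral)
    then show ?thesis by (subst expand) (simp add: N_def sums t field_simps del: One_nat_def)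
  qed
  show "h \<in> tjurina_ideal (normal_form E7)"
  proof (rule tjurina_idealI[OF h])
    \<comment> \<open>The term with \<open>r 0\<close> uses \<open>y^5 = y^2 f_x - x f_y\<close>,
      the term with \<open>q\<close> uses \<open>x^3 = x f_x / 3 - y f_y / 9\<close>.\<close>
    let ?a = "\<lambda>z. taylor 2 0 h / 3 + taylor 2 1 h / 3 * snd z + snd z ^ 2 * r 0 z + 1 / 3 * (fst z * q z)"
    let ?b = "\<lambda>z. 1 / 3 * r 1 z + 1 / 3 * (fst z * r 2 z) - fst z * r 0 z - 1 / 9 * (snd z * q z)"
    show "?a \<in> holomorphic_germs" "?b \<in> holomorphic_germs" by (intro germ_intros qr)+
    show "h (x, y) = ?a (x, y) * partial_x (normal_form E7) (x, y)
        + ?b (x, y) * partial_y (normal_form E7) (x, y)" for x y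
      unfolding normal_form_E7_partials expand by (simp add: field_simps eval_nat_numeral)
  qed
qed (auto intro: holomorphic_germs_normal_form)

section \<open>Tjurina numbers type by type\<close>

fun ade_index :: "ade \<Rightarrow> nat" where
  "ade_index (Ak k) = k"
| "ade_index (Dk k) = k"
| "ade_index E6 = 6"
| "ade_index E7 = 7"
| "ade_index E8 = 8"

lemma tjurina_number_ade:
  assumes equiv: "analytically_equivalent f (normal_form T)" and "valid_ade T"
  shows "tjurina_number f = ade_index T"
proof -
  note tjurina = tjurina_number_analytically_equivalent[OF _ holomorphic_germs_normal_form]
  note Brieskorn = normal_form_Brieskorn[THEN quotient_coordinates_Brieskorn]
  show ?thesis
  proof (cases T)
    case (Ak k)
    have "tjurina_number f = card ({..<1::nat} \<times> {..<k})"
      using equiv unfolding Ak by (rule tjurina[OF _ Brieskorn(1)])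
    then show ?thesis by (simp add: Ak)
  next
    case (Dk k)
    then have k: "k \<ge> 4" using assms(2) by simp
    have "tjurina_number f = card (insert (1, 0) ({0::nat} \<times> {..<k - 1}))"
      using equiv unfolding Dk by (rule tjurina[OF _ quotient_coordinates_Dk[OF k]])
    with k show ?thesis by (simp add: Dk)
  next
    case E6
    have "tjurina_number f = card ({..<2::nat} \<times> {..<3::nat})"
      using equiv unfolding E6 by (rule tjurina[OF _ Brieskorn(2)])
    then show ?thesis by (simp add: E6)
  next
    case E7
    have "tjurina_number f = card ({0::nat} \<times> {..<5::nat} \<union> {1} \<times> {..<2})"
      using equiv unfolding E7 by (rule tjurina[OF _ quotient_coordinates_E7])
    also have "\<dots> = 7" by (subst card_Un_disjoint) auto
    finally show ?thesis by (simp add: E7)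
  next
    case E8
    have "tjurina_number f = card ({..<2::nat} \<times> {..<4::nat})"
      using equiv unfolding E8 by (rule tjurina[OF _ Brieskorn(3)])
    then show ?thesis by (simp add: E8)
  qed
qed


section \<open>MK-curves\<close>

text \<open>In every type the Euler characteristic is the index plus 1, and
  \<open>epsilon T = 1 - 1 / small_group_order T\<close>.\<close>

lemma mk_number_eq:
  assumes "valid_ade T"
  shows "mk_number T = 3 * (real (ade_index T) + epsilon T)"
  using assms by (cases T) (auto simp: mk_number_def field_simps of_nat_diff)

text \<open>Since \<open>epsilon\<close> is 1 minus the reciprocal of the group order, the lower
  bound says that the group is nontrivial, with equality for \<open>Ak 1\<close>, and the upper
  bound that it is finite.\<close>

lemma epsilon_bounds:
  assumes "valid_ade T"
  shows "1 / 2 \<le> epsilon T" "epsilon T < 1"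
  using assms by (cases T; simp add: field_simps)+

theorem corollary3p3:
  fixes n :: nat and C :: ternary_poly
  assumes "reduced_plane_curve n C" and "even n" and "n \<ge> 6" and "simply_singular C"
  shows "(MK_curve n C \<longleftrightarrow>
            real (total_tjurina C) + total_epsilon C = real n / 6 * (5 * real n - 6)) \<and>
         (MK_curve n C \<longrightarrow>
            real (total_tjurina C) + real (card (Sing C)) / 2 \<le> real n / 6 * (5 * real n - 6) \<and>
            real n / 6 * (5 * real n - 6) < real (total_tjurina C) + real (card (Sing C)))"
proof -
  have type: "valid_ade (ade_type C p)"
    "tjurina_number (local_equation C p) = ade_index (ade_type C p)" if "p \<in> Sing C" for p
  proof -
    \<comment> \<open>Simple singularity makes the \<open>SOME\<close> in \<open>ade_type\<close>
      pick a type that occurs at \<open>p\<close>; its index is then the Tjurina number of the local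
      equation.\<close>
    have "has_ade_type C p (ade_type C p)"
      using assms(4) that unfolding simply_singular_def ade_type_def by (auto intro: someI_ex)
    then show "valid_ade (ade_type C p)"
      "tjurina_number (local_equation C p) = ade_index (ade_type C p)"
      using tjurina_number_ade unfolding has_ade_type_def by blast+
  qed
  \<comment> \<open>The pointwise identity is summed over \<open>Sing C\<close>; all three totals
    share the convention that a sum over an infinite set is 0.\<close>
  have mk: "total_mk C = 3 * (real (total_tjurina C) + total_epsilon C)"
    unfolding total_mk_def total_tjurina_def total_epsilon_def
    by (simp add: type mk_number_eq sum.distrib sum_distrib_left distrib_left)
  have iff: "MK_curve n C \<longleftrightarrow>
      real (total_tjurina C) + total_epsilon C = real n / 6 * (5 * real n - 6)"
    using assms unfolding MK_curve_def mk by (auto simp: field_simps)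
  have pos: "real n / 2 * (5 * real n - 6) > 0" using assms(3) by simp
  have "real (card (Sing C)) / 2 \<le> total_epsilon C \<and> total_epsilon C < real (card (Sing C))"
    if MK: "MK_curve n C"
  proof -
    \<comment> \<open>Sums over infinite or empty sets are 0, so a positive total forces finitely
      many singular points and at least one. Finiteness is needed to compare with
      \<open>card\<close>, nonemptiness for strictness of the upper bound.\<close>
    have "total_mk C > 0" using MK pos by (simp only: MK_curve_def)
    then have fin: "finite (Sing C)" "Sing C \<noteq> {}"
      unfolding total_mk_def by (auto intro: ccontr)
    have "(\<Sum>p\<in>Sing C. 1 / 2) \<le> total_epsilon C"
      unfolding total_epsilon_def using type(1) by (intro sum_mono epsilon_bounds)
    moreover have "total_epsilon C < (\<Sum>p\<in>Sing C. 1)"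
      unfolding total_epsilon_def using type(1) fin by (intro sum_strict_mono epsilon_bounds)
    ultimately show ?thesis by simp
  qed
  with iff show ?thesis by force
qed

end
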